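(* Suppose that the bottom in the lower layer is flat, that is, $b=0$. Then any regular solution $(\zeta,\boldsymbol\phi_1,\boldsymbol\phi_2)$ to the Kakinuma model (K) satisfies the conservation of momentum $$\partial_t\boldsymbol m^{\rm K}+\nabla\cdot F_{\boldsymbol m}^{\rm K}=0,$$ where, with $\phi=\rho_2\sum_{j=0}^{N^*}H_2^{p_j}\phi_{2,j}-\rho_1\sum_{j=0}^NH_1^{2j}\phi_{1,j}$, the momentum density and the flux matrix are $$\boldsymbol m^{\rm K}=\zeta\nabla\phi,$$ $$F_{\boldsymbol m}^{\rm K}=-\bigl(\zeta\partial_t\phi+e^{\rm K}\bigr){\rm Id}+\rho_1\sum_{i,j=0}^N\tfrac{1}{2(i+j)+1}H_1^{2(i+j)+1}\nabla\phi_{1,i}\otimes\nabla\phi_{1,j}+\rho_2\sum_{i,j=0}^{N^*}\tfrac{1}{p_i+p_j+1}H_2^{p_i+p_j+1}\nabla\phi_{2,i}\otimes\nabla\phi_{2,j},$$ and $e^{\rm K}$ is the energy density given in the context.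
   Context: Fix integers $n\ge1$, $N,N^*\ge0$, integers $0=p_0<p_1<\dots<p_{N^*}$, and positive constants $g,\rho_1,\rho_2,h_1,h_2$. $\nabla$ acts on $\boldsymbol x\in\mathbf R^n$; the divergence of a matrix is taken row-wise (the matrix here is symmetric). The convention $\frac00=0$ is used for coefficients. Unknowns are $\zeta(\boldsymbol x,t)$, $\boldsymbol\phi_1=(\phi_{1,0},\dots,\phi_{1,N})^{\rm T}$, $\boldsymbol\phi_2=(\phi_{2,0},\dots,\phi_{2,N^*})^{\rm T}$; with $b=0$, $H_1=h_1-\zeta$, $H_2=h_2+\zeta$ (positive). The **Kakinuma model (K)** with $b=0$ is the system $$H_1^{2i}\partial_t\zeta-\sum_{j=0}^N\Bigl\{\nabla\cdot\Bigl(\tfrac{1}{2(i+j)+1}H_1^{2(i+j)+1}\nabla\phi_{1,j}\Bigr)-\tfrac{4ij}{2(i+j)-1}H_1^{2(i+j)-1}\phi_{1,j}\Bigr\}=0\quad(0\le i\le N),$$ $$H_2^{p_i}\partial_t\zeta+\sum_{j=0}^{N^*}\Bigl\{\nabla\cdot\Bigl(\tfrac{1}{p_i+p_j+1}H_2^{p_i+p_j+1}\nabla\phi_{2,j}\Bigr)-\tfrac{p_ip_j}{p_i+p_j-1}H_2^{p_i+p_j-1}\phi_{2,j}\Bigr\}=0\quad(0\le i\le N^* ),$$ $$\rho_1\Bigl\{\sum_{j=0}^NH_1^{2j}\partial_t\phi_{1,j}+g\zeta+\tfrac12(|\boldsymbol u_1|^2+w_1^2)\Bigr\}-\rho_2\Bigl\{\sum_{j=0}^{N^*}H_2^{p_j}\partial_t\phi_{2,j}+g\zeta+\tfrac12(|\boldsymbol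 u_2|^2+w_2^2)\Bigr\}=0,$$ where $\boldsymbol u_1=\sum_jH_1^{2j}\nabla\phi_{1,j}$, $\boldsymbol u_2=\sum_jH_2^{p_j}\nabla\phi_{2,j}$, $w_1=-\sum_j2jH_1^{2j-1}\phi_{1,j}$, $w_2=\sum_jp_jH_2^{p_j-1}\phi_{2,j}$. The energy density (for $b=0$) is $$e^{\rm K}=\tfrac12\rho_1\sum_{i,j=0}^N\Bigl(\tfrac{1}{2(i+j)+1}H_1^{2(i+j)+1}\nabla\phi_{1,i}\cdot\nabla\phi_{1,j}+\tfrac{4ij}{2(i+j)-1}H_1^{2(i+j)-1}\phi_{1,i}\phi_{1,j}\Bigr)+\tfrac12\rho_2\sum_{i,j=0}^{N^*}\Bigl(\tfrac{1}{p_i+p_j+1}H_2^{p_i+p_j+1}\nabla\phi_{2,i}\cdot\nabla\phi_{2,j}+\tfrac{p_ip_j}{p_i+p_j-1}H_2^{p_i+p_j-1}\phi_{2,i}\phi_{2,j}\Bigr)+\tfrac12(\rho_2-\rho_1)g\zeta^2.$$ "Regular" means sufficiently smooth. *)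

theory Defs
  imports "HOL-Analysis.Analysis"
begin

section \<open>Calculus in space-time\<close>

fun Ck_on :: "nat \<Rightarrow> ('a::euclidean_space \<Rightarrow> real) \<Rightarrow> 'a set \<Rightarrow> bool" where
  "Ck_on 0 f S \<longleftrightarrow> continuous_on S f"
| "Ck_on (Suc k) f S \<longleftrightarrow>
     (\<exists>f'. (\<forall>z\<in>S. (f has_derivative f' z) (at z)) \<and> (\<forall>v. Ck_on k (\<lambda>z. f' z v) S))"

definition dt :: "(real^'n \<Rightarrow> real \<Rightarrow> 'a::real_normed_vector) \<Rightarrow> real^'n \<Rightarrow> real \<Rightarrow> 'a" where
  "dt f x t = vector_derivative (\<lambda>s. f x s) (at t)"

definition dx :: "'n::finite \<Rightarrow> (real^'n \<Rightarrow> real \<Rightarrow> real) \<Rightarrow> real^'n \<Rightarrow> real \<Rightarrow> real" where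
  "dx k f x t = vector_derivative (\<lambda>s. f (x + s *\<^sub>R axis k 1) t) (at 0)"

definition grad :: "(real^'n::finite \<Rightarrow> real \<Rightarrow> real) \<Rightarrow> real^'n \<Rightarrow> real \<Rightarrow> real^'n" where
  "grad f x t = (\<chi> k. dx k f x t)"

definition vdiv :: "(real^'n::finite \<Rightarrow> real \<Rightarrow> real^'n) \<Rightarrow> real^'n \<Rightarrow> real \<Rightarrow> real" where
  "vdiv v x t = (\<Sum>k\<in>UNIV. dx k (\<lambda>y s. v y s $ k) x t)"

text \<open>Row-wise divergence: the rows of \<open>F y s\<close> are the vectors \<open>F y s $ k\<close>.\<close>

definition mdiv :: "(real^'n::finite \<Rightarrow> real \<Rightarrow> real^'n^'n) \<Rightarrow> real^'n \<Rightarrow> real \<Rightarrow> real^'n" where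
  "mdiv F x t = (\<chi> k. vdiv (\<lambda>y s. F y s $ k) x t)"

definition tensor :: "real^'n \<Rightarrow> real^'n \<Rightarrow> real^'n^'n" where
  "tensor u v = (\<chi> k l. u $ k * v $ l)"


section \<open>The Kakinuma model over a flat bottom\<close>

text \<open>
  The unknowns are \<open>\<zeta> x t\<close>, \<open>\<phi>1 j x t\<close> for \<open>j \<le> N\<close> and \<open>\<phi>2 j x t\<close> for \<open>j \<le> Ns\<close>, where \<open>Ns\<close>
  stands for \<open>N*\<close>.

  Powers have natural exponents.  An exponent such as \<open>2 * (i + j) - 1\<close> or \<open>p i + p j - 1\<close> is
  truncated at \<open>0\<close> exactly where it should be \<open>-1\<close>, and there its coefficient vanishes.  The
  coefficients themselves are computed in the reals, where \<open>0 / 0 = 0\<close> is the convention used for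
  the model.
\<close>

definition H1 :: "real \<Rightarrow> (real^'n \<Rightarrow> real \<Rightarrow> real) \<Rightarrow> real^'n \<Rightarrow> real \<Rightarrow> real" where
  "H1 h1 \<zeta> x t = h1 - \<zeta> x t"

definition H2 :: "real \<Rightarrow> (real^'n \<Rightarrow> real \<Rightarrow> real) \<Rightarrow> real^'n \<Rightarrow> real \<Rightarrow> real" where
  "H2 h2 \<zeta> x t = h2 + \<zeta> x t"

definition u1 :: "nat \<Rightarrow> real \<Rightarrow> (real^'n::finite \<Rightarrow> real \<Rightarrow> real) \<Rightarrow>
    (nat \<Rightarrow> real^'n \<Rightarrow> real \<Rightarrow> real) \<Rightarrow> real^'n \<Rightarrow> real \<Rightarrow> real^'n" where
  "u1 N h1 \<zeta> \<phi>1 x t = (\<Sum>j\<le>N. H1 h1 \<zeta> x t ^ (2 * j) *\<^sub>R grad (\<phi>1 j) x t)"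

definition u2 :: "nat \<Rightarrow> (nat \<Rightarrow> nat) \<Rightarrow> real \<Rightarrow> (real^'n::finite \<Rightarrow> real \<Rightarrow> real) \<Rightarrow>
    (nat \<Rightarrow> real^'n \<Rightarrow> real \<Rightarrow> real) \<Rightarrow> real^'n \<Rightarrow> real \<Rightarrow> real^'n" where
  "u2 Ns p h2 \<zeta> \<phi>2 x t = (\<Sum>j\<le>Ns. H2 h2 \<zeta> x t ^ p j *\<^sub>R grad (\<phi>2 j) x t)"

definition w1 :: "nat \<Rightarrow> real \<Rightarrow> (real^'n \<Rightarrow> real \<Rightarrow> real) \<Rightarrow>
    (nat \<Rightarrow> real^'n \<Rightarrow> real \<Rightarrow> real) \<Rightarrow> real^'n \<Rightarrow> real \<Rightarrow> real" where
  "w1 N h1 \<zeta> \<phi>1 x t = - (\<Sum>j\<le>N. 2 * real j * H1 h1 \<zeta> x t ^ (2 * j - 1) * \<phi>1 j x t)"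

definition w2 :: "nat \<Rightarrow> (nat \<Rightarrow> nat) \<Rightarrow> real \<Rightarrow> (real^'n \<Rightarrow> real \<Rightarrow> real) \<Rightarrow>
    (nat \<Rightarrow> real^'n \<Rightarrow> real \<Rightarrow> real) \<Rightarrow> real^'n \<Rightarrow> real \<Rightarrow> real" where
  "w2 Ns p h2 \<zeta> \<phi>2 x t = (\<Sum>j\<le>Ns. real (p j) * H2 h2 \<zeta> x t ^ (p j - 1) * \<phi>2 j x t)"

definition kakinuma_eq1 :: "nat \<Rightarrow> real \<Rightarrow> (real^'n::finite \<Rightarrow> real \<Rightarrow> real) \<Rightarrow>
    (nat \<Rightarrow> real^'n \<Rightarrow> real \<Rightarrow> real) \<Rightarrow> nat \<Rightarrow> real^'n \<Rightarrow> real \<Rightarrow> bool" where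
  "kakinuma_eq1 N h1 \<zeta> \<phi>1 i x t \<longleftrightarrow>
     H1 h1 \<zeta> x t ^ (2 * i) * dt \<zeta> x t
     - (\<Sum>j\<le>N.
          vdiv (\<lambda>y s. (1 / (2 * (real i + real j) + 1) * H1 h1 \<zeta> y s ^ (2 * (i + j) + 1))
                        *\<^sub>R grad (\<phi>1 j) y s) x t
          - 4 * real i * real j / (2 * (real i + real j) - 1)
              * H1 h1 \<zeta> x t ^ (2 * (i + j) - 1) * \<phi>1 j x t)
     = 0"

definition kakinuma_eq2 :: "nat \<Rightarrow> (nat \<Rightarrow> nat) \<Rightarrow> real \<Rightarrow> (real^'n::finite \<Rightarrow> real \<Rightarrow> real) \<Rightarrow>
    (nat \<Rightarrow> real^'n \<Rightarrow> real \<Rightarrow> real) \<Rightarrow> nat \<Rightarrow> real^'n \<Rightarrow> real \<Rightarrow> bool" where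
  "kakinuma_eq2 Ns p h2 \<zeta> \<phi>2 i x t \<longleftrightarrow>
     H2 h2 \<zeta> x t ^ p i * dt \<zeta> x t
     + (\<Sum>j\<le>Ns.
          vdiv (\<lambda>y s. (1 / (real (p i) + real (p j) + 1) * H2 h2 \<zeta> y s ^ (p i + p j + 1))
                        *\<^sub>R grad (\<phi>2 j) y s) x t
          - real (p i) * real (p j) / (real (p i) + real (p j) - 1)
              * H2 h2 \<zeta> x t ^ (p i + p j - 1) * \<phi>2 j x t)
     = 0"

definition kakinuma_eq3 :: "nat \<Rightarrow> nat \<Rightarrow> (nat \<Rightarrow> nat) \<Rightarrow> real \<Rightarrow> real \<Rightarrow> real \<Rightarrow> real \<Rightarrow> real \<Rightarrow>
    (real^'n::finite \<Rightarrow> real \<Rightarrow> real) \<Rightarrow> (nat \<Rightarrow> real^'n \<Rightarrow> real \<Rightarrow> real) \<Rightarrow>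
    (nat \<Rightarrow> real^'n \<Rightarrow> real \<Rightarrow> real) \<Rightarrow> real^'n \<Rightarrow> real \<Rightarrow> bool" where
  "kakinuma_eq3 N Ns p g \<rho>1 \<rho>2 h1 h2 \<zeta> \<phi>1 \<phi>2 x t \<longleftrightarrow>
     \<rho>1 * ((\<Sum>j\<le>N. H1 h1 \<zeta> x t ^ (2 * j) * dt (\<phi>1 j) x t) + g * \<zeta> x t
            + 1/2 * ((norm (u1 N h1 \<zeta> \<phi>1 x t))\<^sup>2 + (w1 N h1 \<zeta> \<phi>1 x t)\<^sup>2))
     - \<rho>2 * ((\<Sum>j\<le>Ns. H2 h2 \<zeta> x t ^ p j * dt (\<phi>2 j) x t) + g * \<zeta> x t
            + 1/2 * ((norm (u2 Ns p h2 \<zeta> \<phi>2 x t))\<^sup>2 + (w2 Ns p h2 \<zeta> \<phi>2 x t)\<^sup>2))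
     = 0"

definition kakinuma_solution :: "nat \<Rightarrow> nat \<Rightarrow> (nat \<Rightarrow> nat) \<Rightarrow> real \<Rightarrow> real \<Rightarrow> real \<Rightarrow> real \<Rightarrow> real \<Rightarrow>
    real set \<Rightarrow> (real^'n::finite \<Rightarrow> real \<Rightarrow> real) \<Rightarrow> (nat \<Rightarrow> real^'n \<Rightarrow> real \<Rightarrow> real) \<Rightarrow>
    (nat \<Rightarrow> real^'n \<Rightarrow> real \<Rightarrow> real) \<Rightarrow> bool" where
  "kakinuma_solution N Ns p g \<rho>1 \<rho>2 h1 h2 T \<zeta> \<phi>1 \<phi>2 \<longleftrightarrow>
     (\<forall>x. \<forall>t\<in>T.
        (\<forall>i\<le>N. kakinuma_eq1 N h1 \<zeta> \<phi>1 i x t) \<and>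
        (\<forall>i\<le>Ns. kakinuma_eq2 Ns p h2 \<zeta> \<phi>2 i x t) \<and>
        kakinuma_eq3 N Ns p g \<rho>1 \<rho>2 h1 h2 \<zeta> \<phi>1 \<phi>2 x t)"

text \<open>
  All derivatives entering the model and its momentum balance are of order at most two, so
  ``sufficiently smooth'' is read as jointly of class \<open>C\<^sup>2\<close> in \<open>(x, t)\<close>.
\<close>

definition regular :: "nat \<Rightarrow> nat \<Rightarrow> real set \<Rightarrow> (real^'n::finite \<Rightarrow> real \<Rightarrow> real) \<Rightarrow>
    (nat \<Rightarrow> real^'n \<Rightarrow> real \<Rightarrow> real) \<Rightarrow> (nat \<Rightarrow> real^'n \<Rightarrow> real \<Rightarrow> real) \<Rightarrow> bool" where
  "regular N Ns T \<zeta> \<phi>1 \<phi>2 \<longleftrightarrow>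
     Ck_on 2 (\<lambda>(x, t). \<zeta> x t) (UNIV \<times> T) \<and>
     (\<forall>j\<le>N. Ck_on 2 (\<lambda>(x, t). \<phi>1 j x t) (UNIV \<times> T)) \<and>
     (\<forall>j\<le>Ns. Ck_on 2 (\<lambda>(x, t). \<phi>2 j x t) (UNIV \<times> T))"


section \<open>Energy, momentum and momentum flux\<close>

definition energy_density :: "nat \<Rightarrow> nat \<Rightarrow> (nat \<Rightarrow> nat) \<Rightarrow> real \<Rightarrow> real \<Rightarrow> real \<Rightarrow> real \<Rightarrow> real \<Rightarrow>
    (real^'n::finite \<Rightarrow> real \<Rightarrow> real) \<Rightarrow> (nat \<Rightarrow> real^'n \<Rightarrow> real \<Rightarrow> real) \<Rightarrow>
    (nat \<Rightarrow> real^'n \<Rightarrow> real \<Rightarrow> real) \<Rightarrow> real^'n \<Rightarrow> real \<Rightarrow> real" where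
  "energy_density N Ns p g \<rho>1 \<rho>2 h1 h2 \<zeta> \<phi>1 \<phi>2 x t =
     1/2 * \<rho>1 * (\<Sum>i\<le>N. \<Sum>j\<le>N.
         1 / (2 * (real i + real j) + 1) * H1 h1 \<zeta> x t ^ (2 * (i + j) + 1)
           * (grad (\<phi>1 i) x t \<bullet> grad (\<phi>1 j) x t)
         + 4 * real i * real j / (2 * (real i + real j) - 1)
           * H1 h1 \<zeta> x t ^ (2 * (i + j) - 1) * \<phi>1 i x t * \<phi>1 j x t)
     + 1/2 * \<rho>2 * (\<Sum>i\<le>Ns. \<Sum>j\<le>Ns.
         1 / (real (p i) + real (p j) + 1) * H2 h2 \<zeta> x t ^ (p i + p j + 1)
           * (grad (\<phi>2 i) x t \<bullet> grad (\<phi>2 j) x t)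
         + real (p i) * real (p j) / (real (p i) + real (p j) - 1)
           * H2 h2 \<zeta> x t ^ (p i + p j - 1) * \<phi>2 i x t * \<phi>2 j x t)
     + 1/2 * (\<rho>2 - \<rho>1) * g * (\<zeta> x t)\<^sup>2"

definition phi :: "nat \<Rightarrow> nat \<Rightarrow> (nat \<Rightarrow> nat) \<Rightarrow> real \<Rightarrow> real \<Rightarrow> real \<Rightarrow> real \<Rightarrow>
    (real^'n \<Rightarrow> real \<Rightarrow> real) \<Rightarrow> (nat \<Rightarrow> real^'n \<Rightarrow> real \<Rightarrow> real) \<Rightarrow>
    (nat \<Rightarrow> real^'n \<Rightarrow> real \<Rightarrow> real) \<Rightarrow> real^'n \<Rightarrow> real \<Rightarrow> real" where
  "phi N Ns p \<rho>1 \<rho>2 h1 h2 \<zeta> \<phi>1 \<phi>2 x t =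
     \<rho>2 * (\<Sum>j\<le>Ns. H2 h2 \<zeta> x t ^ p j * \<phi>2 j x t)
     - \<rho>1 * (\<Sum>j\<le>N. H1 h1 \<zeta> x t ^ (2 * j) * \<phi>1 j x t)"

definition momentum_density :: "nat \<Rightarrow> nat \<Rightarrow> (nat \<Rightarrow> nat) \<Rightarrow> real \<Rightarrow> real \<Rightarrow> real \<Rightarrow> real \<Rightarrow>
    (real^'n::finite \<Rightarrow> real \<Rightarrow> real) \<Rightarrow> (nat \<Rightarrow> real^'n \<Rightarrow> real \<Rightarrow> real) \<Rightarrow>
    (nat \<Rightarrow> real^'n \<Rightarrow> real \<Rightarrow> real) \<Rightarrow> real^'n \<Rightarrow> real \<Rightarrow> real^'n" where
  "momentum_density N Ns p \<rho>1 \<rho>2 h1 h2 \<zeta> \<phi>1 \<phi>2 x t =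
     \<zeta> x t *\<^sub>R grad (phi N Ns p \<rho>1 \<rho>2 h1 h2 \<zeta> \<phi>1 \<phi>2) x t"

definition momentum_flux :: "nat \<Rightarrow> nat \<Rightarrow> (nat \<Rightarrow> nat) \<Rightarrow> real \<Rightarrow> real \<Rightarrow> real \<Rightarrow> real \<Rightarrow> real \<Rightarrow>
    (real^'n::finite \<Rightarrow> real \<Rightarrow> real) \<Rightarrow> (nat \<Rightarrow> real^'n \<Rightarrow> real \<Rightarrow> real) \<Rightarrow>
    (nat \<Rightarrow> real^'n \<Rightarrow> real \<Rightarrow> real) \<Rightarrow> real^'n \<Rightarrow> real \<Rightarrow> real^'n^'n" where
  "momentum_flux N Ns p g \<rho>1 \<rho>2 h1 h2 \<zeta> \<phi>1 \<phi>2 x t =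
     - (\<zeta> x t * dt (phi N Ns p \<rho>1 \<rho>2 h1 h2 \<zeta> \<phi>1 \<phi>2) x t
        + energy_density N Ns p g \<rho>1 \<rho>2 h1 h2 \<zeta> \<phi>1 \<phi>2 x t) *\<^sub>R mat 1
     + \<rho>1 *\<^sub>R (\<Sum>i\<le>N. \<Sum>j\<le>N.
         (1 / (2 * (real i + real j) + 1) * H1 h1 \<zeta> x t ^ (2 * (i + j) + 1))
           *\<^sub>R tensor (grad (\<phi>1 i) x t) (grad (\<phi>1 j) x t))
     + \<rho>2 *\<^sub>R (\<Sum>i\<le>Ns. \<Sum>j\<le>Ns.
         (1 / (real (p i) + real (p j) + 1) * H2 h2 \<zeta> x t ^ (p i + p j + 1))
           *\<^sub>R tensor (grad (\<phi>2 i) x t) (grad (\<phi>2 j) x t))"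

end

(* Both layers obey the same balance. With \<psi> = (\<Sum>j. H ^ q j * \<phi> j), the Kakinuma equations of a
   single layer of thickness H read H ^ q i * H_t + (\<Sum>j. ...) = 0 (for the upper layer H_t = -\<zeta>_t
   accounts for the opposite sign). Multiplying the i-th one by the k-th spatial derivative of \<phi> i
   and summing over i shows that the divergence of the layer flux minus the gradient of the layer
   energy equals (grad H) \<psi>_t - H_t (grad \<psi>) - (grad H) B, where B is the layer's contribution
   to the Bernoulli equation. In the \<rho>-weighted sum the Bernoulli equation turns the B terms into the
   gradient of the potential energy, and the rest cancels against the derivatives of
   \<zeta> (grad \<phi>) and \<zeta> \<phi>_t because mixed second derivatives commute. *)

theory Submission
  imports Defs
begin

section \<open>Functions of class \<open>C\<^sup>k\<close>\<close>

text \<open>A derivative at \<open>z\<close> depends on a whole neighbourhood of \<open>z\<close>;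
  as \<open>S\<close> is open, agreement on \<open>S\<close> suffices to transfer it.\<close>

lemma Ck_on_cong:
  assumes "open S" and "\<And>z. z \<in> S \<Longrightarrow> f z = g z"
  shows "Ck_on k f S \<longleftrightarrow> Ck_on k g S"
proof (cases k)
  case 0
  then show ?thesis using assms(2) by (simp cong: continuous_on_cong)
next
  case (Suc m)
  have "(f has_derivative f' z) (at z) \<longleftrightarrow> (g has_derivative f' z) (at z)" if "z \<in> S" for f' z
    using assms that has_derivative_transform_within_open[of f "f' z" z UNIV S g]
      has_derivative_transform_within_open[of g "f' z" z UNIV S f] by auto
  with Suc show ?thesis by simp
qed

lemma Ck_on_imp_continuous_on: "Ck_on k f S \<Longrightarrow> continuous_on S f"
  by (cases k)
    (auto simp: continuous_on_eq_continuous_within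
      intro: has_derivative_continuous has_derivative_at_withinI)

lemma Ck_on_Suc_imp: "Ck_on (Suc k) f S \<Longrightarrow> Ck_on k f S"
proof (induction k arbitrary: f)
  case 0
  then show ?case using Ck_on_imp_continuous_on by fastforce
next
  case (Suc k)
  then show ?case by (metis Ck_on.simps(2))
qed

section \<open>Algebra of functions of class C^k\<close>

lemma Ck_on_const: "Ck_on k (\<lambda>z. c) S"
proof (induction k arbitrary: c)
  case (Suc k)
  then show ?case by (auto intro!: exI[of _ "\<lambda>z v. 0"])
qed simp

lemma Ck_on_add: "Ck_on k f S \<Longrightarrow> Ck_on k g S \<Longrightarrow> Ck_on k (\<lambda>z. f z + g z) S"
proof (induction k arbitrary: f g)
  case (Suc k)
  from Suc.prems obtain f' g' where
    "\<forall>z\<in>S. (f has_derivative f' z) (at z)" "\<forall>v. Ck_on k (\<lambda>z. f' z v) S"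
    "\<forall>z\<in>S. (g has_derivative g' z) (at z)" "\<forall>v. Ck_on k (\<lambda>z. g' z v) S"
    by auto
  then show ?case
    by (auto intro!: exI[of _ "\<lambda>z v. f' z v + g' z v"] has_derivative_add Suc.IH)
qed (simp add: continuous_on_add)

lemma Ck_on_mult: "Ck_on k f S \<Longrightarrow> Ck_on k g S \<Longrightarrow> Ck_on k (\<lambda>z. f z * g z) S"
proof (induction k arbitrary: f g)
  case (Suc k)
  from Suc.prems obtain f' g' where
    "\<forall>z\<in>S. (f has_derivative f' z) (at z)" "\<forall>v. Ck_on k (\<lambda>z. f' z v) S"
    "\<forall>z\<in>S. (g has_derivative g' z) (at z)" "\<forall>v. Ck_on k (\<lambda>z. g' z v) S"
    by auto
  \<comment> \<open>The product rule leaves one factor undifferentiated, so \<open>f\<close> and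
    \<open>g\<close> themselves must also be known to be of class \<open>k\<close>.\<close>
  with Suc.prems[THEN Ck_on_Suc_imp] show ?case
    by (auto intro!: exI[of _ "\<lambda>z v. f z * g' z v + f' z v * g z"] has_derivative_mult
        Ck_on_add Suc.IH)
qed (simp add: continuous_on_mult)

section \<open>Symmetry of the second derivative\<close>

text \<open>Two applications of the mean value theorem, first along \<open>v\<close> and then along
  \<open>w\<close>, turn the quotient into \<open>g y w\<close> at a point \<open>y\<close> that
  tends to \<open>z\<close>; continuity of this one mixed derivative then gives the limit.\<close>

lemma second_difference_quotient_tendsto:
  fixes f :: "'a::euclidean_space \<Rightarrow> real"
  assumes "open S" "z \<in> S"
    and f: "\<And>y. y \<in> S \<Longrightarrow> (f has_derivative f' y) (at y)"
    and g: "\<And>y. y \<in> S \<Longrightarrow> ((\<lambda>y. f' y v) has_derivative g y) (at y)"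
    and cont: "continuous_on S (\<lambda>y. g y w)"
  shows "((\<lambda>h. (f (z + h *\<^sub>R v + h *\<^sub>R w) - f (z + h *\<^sub>R v) - f (z + h *\<^sub>R w) + f z) / h\<^sup>2)
    \<longlongrightarrow> g z w) (at_right 0)"
proof (rule tendstoI)
  fix e :: real assume "e > 0"
  have "isCont (\<lambda>y. g y w) z"
    using cont assms(1,2) continuous_on_eq_continuous_at by blast
  then obtain d1 where d1: "d1 > 0" "\<And>y. dist y z < d1 \<Longrightarrow> dist (g y w) (g z w) < e"
    using \<open>e > 0\<close> unfolding continuous_at_eps_delta dist_norm real_norm_def by blast
  obtain d2 where d2: "d2 > 0" "\<And>y. dist y z < d2 \<Longrightarrow> y \<in> S"
    using assms(1,2) open_dist by metis
  \<comment> \<open>Below \<open>d\<close>, all points \<open>z + a v + b w\<close> stay within both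
    \<open>d1\<close> and \<open>d2\<close> of \<open>z\<close>. The summand 1 keeps the denominator
    positive when \<open>v\<close> and \<open>w\<close> vanish.\<close>
  define d where "d = min d1 d2 / (norm v + norm w + 1)"
  have pos: "norm v + norm w + 1 > 0" by (smt (verit) norm_ge_zero)
  have "d > 0" using d1(1) d2(1) pos by (simp add: d_def)
  have near: "dist (z + a *\<^sub>R v + b *\<^sub>R w) z < min d1 d2"
    if "0 \<le> a" "a < d" "0 \<le> b" "b < d" for a b
  proof -
    have "dist (z + a *\<^sub>R v + b *\<^sub>R w) z \<le> a * norm v + b * norm w"
      using that norm_triangle_ineq[of "a *\<^sub>R v" "b *\<^sub>R w"] by (simp add: dist_norm add.assoc)
    also have "\<dots> \<le> d * norm v + d * norm w"
      using that by (intro add_mono mult_right_mono) auto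
    also have "\<dots> < d * (norm v + norm w + 1)" using \<open>d > 0\<close> by (simp add: algebra_simps)
    also have "\<dots> = min d1 d2" using pos by (simp add: d_def)
    finally show ?thesis .
  qed
  have "dist ((f (z + h *\<^sub>R v + h *\<^sub>R w) - f (z + h *\<^sub>R v) - f (z + h *\<^sub>R w) + f z) / h\<^sup>2)
      (g z w) < e" if h: "0 < h" "h < d" for h
  proof -
    have inS: "z + a *\<^sub>R v + b *\<^sub>R w \<in> S" if "0 \<le> a" "a \<le> h" "0 \<le> b" "b \<le> h" for a b
      using near[of a b] d2(2) that h by auto
    have inS0: "z + a *\<^sub>R v \<in> S" if "0 \<le> a" "a \<le> h" for a
      using inS[of a 0] that h by simp
    \<comment> \<open>The numerator of the quotient is \<open>?F h - ?F 0\<close>, an increment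
      along \<open>v\<close> of the increment of \<open>f\<close> along \<open>w\<close>.\<close>
    let ?F = "\<lambda>a. f (z + a *\<^sub>R v + h *\<^sub>R w) - f (z + a *\<^sub>R v)"
    have lin1: "f' y (a *\<^sub>R u) = a * f' y u" if "y \<in> S" for a y u
      using linear_scale[OF has_derivative_linear[OF f[OF that]]] by simp
    have lin2: "g y (a *\<^sub>R u) = a * g y u" if "y \<in> S" for a y u
      using linear_scale[OF has_derivative_linear[OF g[OF that]]] by simp
    let ?D = "\<lambda>a. f' (z + a *\<^sub>R v + h *\<^sub>R w) v - f' (z + a *\<^sub>R v) v"
    have "(?F has_real_derivative ?D a) (at a)" if a: "0 \<le> a" "a \<le> h" for a
    proof -
      have S: "z + a *\<^sub>R v + h *\<^sub>R w \<in> S" "z + a *\<^sub>R v \<in> S"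
        using inS[of a h] inS0[of a] a h by auto
      have line: "((\<lambda>a. z + a *\<^sub>R v + c) has_derivative (\<lambda>s. s *\<^sub>R v)) (at a)" for c
        by (auto intro!: derivative_eq_intros)
      have "(?F has_derivative (\<lambda>s. f' (z + a *\<^sub>R v + h *\<^sub>R w) (s *\<^sub>R v) - f' (z + a *\<^sub>R v) (s *\<^sub>R v))) (at a)"
        using has_derivative_diff[OF has_derivative_compose[OF line f[OF S(1)]]
            has_derivative_compose[OF line[of 0, simplified] f[OF S(2)]]] .
      then show ?thesis
        unfolding has_field_derivative_def lin1[OF S(1)] lin1[OF S(2)]
        by (simp only: right_diff_distrib[symmetric] mult.commute[of _ "?D a"])
    qed
    from MVT2[OF h(1) this] obtain a where a: "0 < a" "a < h" "?F h - ?F 0 = (h - 0) * ?D a"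
      by blast
    \<comment> \<open>The derivative \<open>?D a\<close> of \<open>?F\<close> is itself the
      increment \<open>?G h - ?G 0\<close> along \<open>w\<close>, which yields the second factor
      \<open>h\<close>.\<close>
    let ?G = "\<lambda>b. f' (z + a *\<^sub>R v + b *\<^sub>R w) v"
    have "(?G has_real_derivative g (z + a *\<^sub>R v + b *\<^sub>R w) w) (at b)"
      if b: "0 \<le> b" "b \<le> h" for b
    proof -
      have S: "z + a *\<^sub>R v + b *\<^sub>R w \<in> S" using inS[of a b] a b by simp
      have line: "((\<lambda>b. z + a *\<^sub>R v + b *\<^sub>R w) has_derivative (\<lambda>s. s *\<^sub>R w)) (at b)"
        by (auto intro!: derivative_eq_intros)
      show ?thesis
        using has_derivative_compose[OF line g[OF S]]
        unfolding has_field_derivative_def lin2[OF S]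
        by (simp only: mult.commute[of _ "g (z + a *\<^sub>R v + b *\<^sub>R w) w"])
    qed
    from MVT2[OF h(1) this] obtain b where b: "0 < b" "b < h"
      "?G h - ?G 0 = (h - 0) * g (z + a *\<^sub>R v + b *\<^sub>R w) w"
      by blast
    have "f (z + h *\<^sub>R v + h *\<^sub>R w) - f (z + h *\<^sub>R v) - f (z + h *\<^sub>R w) + f z
        = h\<^sup>2 * g (z + a *\<^sub>R v + b *\<^sub>R w) w"
      using a(3) b(3) by (simp add: power2_eq_square)
    then show ?thesis using d1(2)[of "z + a *\<^sub>R v + b *\<^sub>R w"] near[of a b] a b h by simp
  qed
  then show "\<forall>\<^sub>F h in at_right 0. dist ((f (z + h *\<^sub>R v + h *\<^sub>R w) - f (z + h *\<^sub>R v)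
      - f (z + h *\<^sub>R w) + f z) / h\<^sup>2) (g z w) < e"
    using \<open>d > 0\<close> by (auto simp: eventually_at_right_field)
qed

text \<open>The second difference does not change when \<open>v\<close> and \<open>w\<close> are
  exchanged, so both mixed derivatives are limits of the same quotient.\<close>

lemma second_derivative_symmetric:
  fixes f :: "'a::euclidean_space \<Rightarrow> real"
  assumes "open S" "z \<in> S"
    and "\<And>y. y \<in> S \<Longrightarrow> (f has_derivative f' y) (at y)"
    and "\<And>u y. y \<in> S \<Longrightarrow> ((\<lambda>y. f' y u) has_derivative f'' u y) (at y)"
    and "\<And>u w. continuous_on S (\<lambda>y. f'' u y w)"
  shows "f'' v z w = f'' w z v"
proof (rule tendsto_unique)
  show "((\<lambda>h. (f (z + h *\<^sub>R v + h *\<^sub>R w) - f (z + h *\<^sub>R v) - f (z + h *\<^sub>R w) + f z) / h\<^sup>2)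
    \<longlongrightarrow> f'' v z w) (at_right 0)"
    by (rule second_difference_quotient_tendsto[OF assms(1-5)])
  have "((\<lambda>h. (f (z + h *\<^sub>R w + h *\<^sub>R v) - f (z + h *\<^sub>R w) - f (z + h *\<^sub>R v) + f z) / h\<^sup>2)
    \<longlongrightarrow> f'' w z v) (at_right 0)"
    by (rule second_difference_quotient_tendsto[OF assms(1-5)])
  moreover have "f (z + h *\<^sub>R w + h *\<^sub>R v) - f (z + h *\<^sub>R w) - f (z + h *\<^sub>R v) + f z
      = f (z + h *\<^sub>R v + h *\<^sub>R w) - f (z + h *\<^sub>R v) - f (z + h *\<^sub>R w) + f z" for h
    by (simp add: add.assoc add.commute[of "h *\<^sub>R w" "h *\<^sub>R v"])
  ultimately show "((\<lambda>h. (f (z + h *\<^sub>R v + h *\<^sub>R w) - f (z + h *\<^sub>R v) - f (z + h *\<^sub>R w) + f z) / h\<^sup>2)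
    \<longlongrightarrow> f'' w z v) (at_right 0)"
    by simp
qed simp

lemma Ck_on_power: "Ck_on k f S \<Longrightarrow> Ck_on k (\<lambda>z. f z ^ m) S"
  by (induction m) (auto intro: Ck_on_mult Ck_on_const)

lemma Ck_on_sum: "(\<And>i. i \<in> I \<Longrightarrow> Ck_on k (f i) S) \<Longrightarrow> Ck_on k (\<lambda>z. \<Sum>i\<in>I. f i z) S"
  by (induction I rule: infinite_finite_induct) (auto intro: Ck_on_add Ck_on_const)

section \<open>Partial derivatives in space-time\<close>

text \<open>Curried version of \<open>Ck_on\<close> on the slab over \<open>T\<close>, matching the
  functions of \<open>x\<close> and \<open>t\<close> on which \<open>dx\<close> and
  \<open>dt\<close> act.\<close>

definition smooth :: "real set \<Rightarrow> nat \<Rightarrow> (real^'n::finite \<Rightarrow> real \<Rightarrow> real) \<Rightarrow> bool" where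
  "smooth T k f \<longleftrightarrow> Ck_on k (\<lambda>(x, t). f x t) (UNIV \<times> T)"

lemma smooth_const: "smooth T k (\<lambda>y s. c)"
  by (simp add: smooth_def Ck_on_const split_beta')

lemma smooth_add: "smooth T k f \<Longrightarrow> smooth T k g \<Longrightarrow> smooth T k (\<lambda>y s. f y s + g y s)"
  by (simp add: smooth_def Ck_on_add split_beta')

lemma smooth_mult: "smooth T k f \<Longrightarrow> smooth T k g \<Longrightarrow> smooth T k (\<lambda>y s. f y s * g y s)"
  by (simp add: smooth_def Ck_on_mult split_beta')

lemma smooth_diff:
  assumes "smooth T k f" "smooth T k g"
  shows "smooth T k (\<lambda>y s. f y s - g y s)"
  using smooth_add[OF assms(1) smooth_mult[OF smooth_const[of T k "-1"] assms(2)]] by simp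

lemma smooth_power: "smooth T k f \<Longrightarrow> smooth T k (\<lambda>y s. f y s ^ m)"
  by (simp add: smooth_def Ck_on_power split_beta')

lemma smooth_sum:
  "(\<And>i. i \<in> I \<Longrightarrow> smooth T k (f i)) \<Longrightarrow> smooth T k (\<lambda>y s. \<Sum>i\<in>I. f i y s)"
  by (simp add: smooth_def Ck_on_sum split_beta')

lemma smooth_Suc_imp: "smooth T (Suc k) f \<Longrightarrow> smooth T k f"
  unfolding smooth_def by (rule Ck_on_Suc_imp)

lemma smooth_2_imp_1: "smooth T 2 f \<Longrightarrow> smooth T 1 f"
  unfolding numeral_2_eq_2 One_nat_def by (rule smooth_Suc_imp)

section \<open>Partial derivatives as values of the total derivative\<close>

text \<open>The chain rule along a coordinate line. It reduces every rule for \<open>dx\<close> to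
  the corresponding rule for the total derivative.\<close>

lemma dx_eq_derivative:
  assumes "((\<lambda>(x, t). f x t) has_derivative f') (at (x, t))"
  shows "dx k f x t = f' (axis k 1, 0)"
proof -
  have line: "((\<lambda>s. (x + s *\<^sub>R axis k 1, t)) has_derivative (\<lambda>s. (s *\<^sub>R axis k 1, 0))) (at 0)"
    by (auto intro!: derivative_eq_intros)
  have "((\<lambda>s. f (x + s *\<^sub>R axis k 1) t) has_derivative (\<lambda>s. f' (s *\<^sub>R axis k 1, 0))) (at 0)"
    using has_derivative_compose[OF line, of "case_prod f" f'] assms by simp
  moreover have "f' (s *\<^sub>R axis k 1, 0) = s *\<^sub>R f' (axis k 1, 0)" for s
    using linear_scale[OF has_derivative_linear[OF assms], of s "(axis k 1, 0)"] by simp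
  ultimately show ?thesis
    unfolding dx_def by (intro vector_derivative_at) (simp add: has_vector_derivative_def)
qed

lemma dt_eq_derivative:
  assumes "((\<lambda>(x, t). f x t) has_derivative f') (at (x, t))"
  shows "((\<lambda>s. f x s) has_vector_derivative f' (0, 1)) (at t)" and "dt f x t = f' (0, 1)"
proof -
  have line: "((\<lambda>s. (x, s)) has_derivative (\<lambda>s. (0, s))) (at t)"
    by (auto intro!: derivative_eq_intros)
  have "((\<lambda>s. f x s) has_derivative (\<lambda>s. f' (0, s))) (at t)"
    using has_derivative_compose[OF line, of "case_prod f" f'] assms by simp
  moreover have "f' (0, s) = s *\<^sub>R f' (0, 1)" for s
    using linear_scale[OF has_derivative_linear[OF assms], of s "(0, 1)"] by (simp only: scaleR_Pair) simp
  then have "(\<lambda>s. f' (0, s)) = (\<lambda>s. s *\<^sub>R f' (0, 1))" by (rule ext)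
  ultimately show "((\<lambda>s. f x s) has_vector_derivative f' (0, 1)) (at t)"
    unfolding has_vector_derivative_def by (simp only:)
  then show "dt f x t = f' (0, 1)"
    unfolding dt_def by (rule vector_derivative_at)
qed

lemma smooth_1_derivative:
  assumes "smooth T 1 f" "t \<in> T"
  obtains f' where "((\<lambda>(x, t). f x t) has_derivative f') (at (x, t))"
proof -
  have "\<exists>f'. (\<forall>z\<in>UNIV \<times> T. ((\<lambda>(x, t). f x t) has_derivative f' z) (at z)) \<and>
      (\<forall>v. Ck_on 0 (\<lambda>z. f' z v) (UNIV \<times> T))"
    using assms(1) unfolding smooth_def One_nat_def Ck_on.simps(2) .
  then obtain f' where "\<forall>z\<in>UNIV \<times> T. ((\<lambda>(x, t). f x t) has_derivative f' z) (at z)"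
    by (elim exE conjE)
  then show thesis using assms(2) by (intro that[of "f' (x, t)"]) (rule bspec, auto)
qed

text \<open>\<open>dt\<close> denotes some value even where no derivative exists, so
  differentiability is recorded separately; the momentum density is later differentiated
  componentwise from this fact.\<close>

lemma has_vector_derivative_dt:
  assumes "smooth T 1 f" "t \<in> T"
  shows "((\<lambda>s. f x s) has_vector_derivative dt f x t) (at t)"
proof -
  obtain f' where d: "((\<lambda>(x, t). f x t) has_derivative f') (at (x, t))"
    using smooth_1_derivative[OF assms] .
  show ?thesis using dt_eq_derivative[OF d] by simp
qed

section \<open>Differentiation rules for \<open>dx\<close> and \<open>dt\<close>\<close>

lemma partial_const: "dx k (\<lambda>y s. c) x t = 0" "dt (\<lambda>y s. c) x t = 0"
  by (simp_all add: dx_def dt_def)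

lemma partial_add:
  assumes "smooth T 1 f" "smooth T 1 g" "t \<in> T"
  shows "dx k (\<lambda>y s. f y s + g y s) x t = dx k f x t + dx k g x t"
    and "dt (\<lambda>y s. f y s + g y s) x t = dt f x t + dt g x t"
proof -
  obtain f' where f': "((\<lambda>(x, t). f x t) has_derivative f') (at (x, t))"
    using smooth_1_derivative[OF assms(1,3)] .
  obtain g' where g': "((\<lambda>(x, t). g x t) has_derivative g') (at (x, t))"
    using smooth_1_derivative[OF assms(2,3)] .
  note d = f' g'
  have d': "((\<lambda>(y, s). f y s + g y s) has_derivative (\<lambda>v. f' v + g' v)) (at (x, t))"
    using has_derivative_add[OF d] by (simp add: split_beta')
  show "dx k (\<lambda>y s. f y s + g y s) x t = dx k f x t + dx k g x t"
    "dt (\<lambda>y s. f y s + g y s) x t = dt f x t + dt g x t"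
    by (simp_all add: dx_eq_derivative[OF d'] dx_eq_derivative[OF d(1)] dx_eq_derivative[OF d(2)]
        dt_eq_derivative(2)[OF d'] dt_eq_derivative(2)[OF d(1)] dt_eq_derivative(2)[OF d(2)])
qed

lemma partial_mult:
  assumes "smooth T 1 f" "smooth T 1 g" "t \<in> T"
  shows "dx k (\<lambda>y s. f y s * g y s) x t = f x t * dx k g x t + dx k f x t * g x t"
    and "dt (\<lambda>y s. f y s * g y s) x t = f x t * dt g x t + dt f x t * g x t"
proof -
  obtain f' where f': "((\<lambda>(x, t). f x t) has_derivative f') (at (x, t))"
    using smooth_1_derivative[OF assms(1,3)] .
  obtain g' where g': "((\<lambda>(x, t). g x t) has_derivative g') (at (x, t))"
    using smooth_1_derivative[OF assms(2,3)] .
  note d = f' g'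
  have d': "((\<lambda>(y, s). f y s * g y s) has_derivative (\<lambda>v. f x t * g' v + f' v * g x t)) (at (x, t))"
    using has_derivative_mult[OF d] by (simp add: split_beta')
  show "dx k (\<lambda>y s. f y s * g y s) x t = f x t * dx k g x t + dx k f x t * g x t"
    "dt (\<lambda>y s. f y s * g y s) x t = f x t * dt g x t + dt f x t * g x t"
    by (simp_all add: dx_eq_derivative[OF d'] dx_eq_derivative[OF d(1)] dx_eq_derivative[OF d(2)]
        dt_eq_derivative(2)[OF d'] dt_eq_derivative(2)[OF d(1)] dt_eq_derivative(2)[OF d(2)])
qed

lemma partial_cmult:
  assumes "smooth T 1 f" "t \<in> T"
  shows "dx k (\<lambda>y s. c * f y s) x t = c * dx k f x t"
    and "dt (\<lambda>y s. c * f y s) x t = c * dt f x t"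
  using partial_mult[OF smooth_const assms] by (simp_all add: partial_const)

lemma partial_diff:
  assumes "smooth T 1 f" "smooth T 1 g" "t \<in> T"
  shows "dx k (\<lambda>y s. f y s - g y s) x t = dx k f x t - dx k g x t"
    and "dt (\<lambda>y s. f y s - g y s) x t = dt f x t - dt g x t"
proof -
  have m: "smooth T 1 (\<lambda>y s. - 1 * g y s)" by (rule smooth_mult[OF smooth_const assms(2)])
  show "dx k (\<lambda>y s. f y s - g y s) x t = dx k f x t - dx k g x t"
    using partial_add(1)[OF assms(1) m assms(3), of k x]
      partial_cmult(1)[OF assms(2,3), of k "-1" x] by simp
  show "dt (\<lambda>y s. f y s - g y s) x t = dt f x t - dt g x t"
    using partial_add(2)[OF assms(1) m assms(3), of x]
      partial_cmult(2)[OF assms(2,3), of "-1" x] by simp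
qed

text \<open>For \<open>m = 0\<close> the truncated exponent \<open>m - 1\<close> is harmless because
  the factor \<open>real m\<close> vanishes.\<close>

lemma partial_power:
  assumes "smooth T 1 f" "t \<in> T"
  shows "dx k (\<lambda>y s. f y s ^ m) x t = real m * f x t ^ (m - 1) * dx k f x t"
    and "dt (\<lambda>y s. f y s ^ m) x t = real m * f x t ^ (m - 1) * dt f x t"
proof -
  obtain f' where d: "((\<lambda>(x, t). f x t) has_derivative f') (at (x, t))"
    using smooth_1_derivative[OF assms] .
  have d': "((\<lambda>(y, s). f y s ^ m) has_derivative (\<lambda>v. real m * f' v * f x t ^ (m - 1))) (at (x, t))"
    using has_derivative_power[OF d, of m] by (simp add: split_beta')
  show "dx k (\<lambda>y s. f y s ^ m) x t = real m * f x t ^ (m - 1) * dx k f x t"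
    "dt (\<lambda>y s. f y s ^ m) x t = real m * f x t ^ (m - 1) * dt f x t"
    by (simp_all add: dx_eq_derivative[OF d'] dx_eq_derivative[OF d] dt_eq_derivative(2)[OF d']
        dt_eq_derivative(2)[OF d])
qed

lemma partial_sum:
  assumes "\<And>i. i \<in> I \<Longrightarrow> smooth T 1 (f i)" "t \<in> T"
  shows "dx k (\<lambda>y s. \<Sum>i\<in>I. f i y s) x t = (\<Sum>i\<in>I. dx k (f i) x t)"
    and "dt (\<lambda>y s. \<Sum>i\<in>I. f i y s) x t = (\<Sum>i\<in>I. dt (f i) x t)"
proof -
  have "dx k (\<lambda>y s. \<Sum>i\<in>I. f i y s) x t = (\<Sum>i\<in>I. dx k (f i) x t) \<and>
      dt (\<lambda>y s. \<Sum>i\<in>I. f i y s) x t = (\<Sum>i\<in>I. dt (f i) x t)"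
    using assms(1)
  proof (induction I rule: infinite_finite_induct)
    case (insert i I)
    then have "smooth T 1 (f i)" "smooth T 1 (\<lambda>y s. \<Sum>i\<in>I. f i y s)"
      by (auto intro: smooth_sum)
    from partial_add[OF this assms(2)] insert show ?case by simp
  qed (simp_all add: partial_const)
  then show "dx k (\<lambda>y s. \<Sum>i\<in>I. f i y s) x t = (\<Sum>i\<in>I. dx k (f i) x t)"
    "dt (\<lambda>y s. \<Sum>i\<in>I. f i y s) x t = (\<Sum>i\<in>I. dt (f i) x t)" by auto
qed

section \<open>Regularity and commutation of partial derivatives\<close>

text \<open>One witness \<open>f'\<close> serves all clauses, so regularity of its values carries
  over to \<open>dx\<close> and \<open>dt\<close>.\<close>

lemma smooth_Suc_derivative:
  assumes "smooth T (Suc k) f"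
  shows "\<exists>f'. (\<forall>z\<in>UNIV \<times> T. ((\<lambda>(x, t). f x t) has_derivative f' z) (at z)) \<and>
    (\<forall>v. Ck_on k (\<lambda>z. f' z v) (UNIV \<times> T)) \<and>
    (\<forall>l x. \<forall>t\<in>T. dx l f x t = f' (x, t) (axis l 1, 0)) \<and>
    (\<forall>x. \<forall>t\<in>T. dt f x t = f' (x, t) (0, 1))"
proof -
  have "\<exists>f'. (\<forall>z\<in>UNIV \<times> T. ((\<lambda>(x, t). f x t) has_derivative f' z) (at z)) \<and>
      (\<forall>v. Ck_on k (\<lambda>z. f' z v) (UNIV \<times> T))"
    using assms unfolding smooth_def Ck_on.simps(2) .
  then obtain f' where f': "\<forall>z\<in>UNIV \<times> T. ((\<lambda>(x, t). f x t) has_derivative f' z) (at z)"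
    "\<forall>v. Ck_on k (\<lambda>z. f' z v) (UNIV \<times> T)"
    by (elim exE conjE)
  have d: "((\<lambda>(x, t). f x t) has_derivative f' (x, t)) (at (x, t))" if "t \<in> T" for x t
    using f'(1) that by blast
  show ?thesis
    using f' dx_eq_derivative[OF d] dt_eq_derivative(2)[OF d] by (intro exI[of _ f']) blast
qed

text \<open>On the open slab a partial derivative coincides with \<open>f'\<close> applied to a
  fixed vector, which is of class \<open>k\<close> by the definition of
  \<open>Ck_on\<close>.\<close>

lemma smooth_partial:
  fixes f :: "real^'n::finite \<Rightarrow> real \<Rightarrow> real"
  assumes "smooth T (Suc k) f" "open T"
  shows "smooth T k (dx l f)" and "smooth T k (dt f)"
proof -
  from smooth_Suc_derivative[OF assms(1)] obtain f' where
    "\<forall>z\<in>UNIV \<times> T. ((\<lambda>(x, t). f x t) has_derivative f' z) (at z)"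
    "\<forall>v. Ck_on k (\<lambda>z. f' z v) (UNIV \<times> T)"
    "\<forall>l x. \<forall>t\<in>T. dx l f x t = f' (x, t) (axis l 1, 0)"
    "\<forall>x. \<forall>t\<in>T. dt f x t = f' (x, t) (0, 1)"
    by (elim exE conjE)
  note f' = this[rule_format]
  have op: "open (UNIV \<times> T :: ((real^'n) \<times> real) set)" using assms(2) by (simp add: open_Times)
  show "smooth T k (dx l f)"
    unfolding smooth_def
    by (subst Ck_on_cong[OF op, where g = "\<lambda>z. f' z (axis l 1, 0)"]) (auto simp: f'(2,3))
  show "smooth T k (dt f)"
    unfolding smooth_def
    by (subst Ck_on_cong[OF op, where g = "\<lambda>z. f' z (0, 1)"]) (auto simp: f'(2,4))
qed

text \<open>Symmetry of the second derivative, evaluated on the directions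
  \<open>(axis k 1, 0)\<close>, \<open>(axis l 1, 0)\<close> and \<open>(0, 1)\<close>.\<close>

lemma partial_commute:
  fixes f :: "real^'n::finite \<Rightarrow> real \<Rightarrow> real"
  assumes "smooth T 2 f" "open T" "t \<in> T"
  shows "dx k (dx l f) x t = dx l (dx k f) x t" and "dt (dx k f) x t = dx k (dt f) x t"
proof -
  have op: "open (UNIV \<times> T :: ((real^'n) \<times> real) set)" using assms(2) by (simp add: open_Times)
  from smooth_Suc_derivative[OF assms(1)[unfolded numeral_2_eq_2]] obtain f' where
    "\<forall>z\<in>UNIV \<times> T. ((\<lambda>(x, t). f x t) has_derivative f' z) (at z)"
    "\<forall>v. Ck_on (Suc 0) (\<lambda>z. f' z v) (UNIV \<times> T)"
    "\<forall>l x. \<forall>t\<in>T. dx l f x t = f' (x, t) (axis l 1, 0)"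
    "\<forall>x. \<forall>t\<in>T. dt f x t = f' (x, t) (0, 1)"
    by (elim exE conjE)
  note f' = this[rule_format]
  \<comment> \<open>\<open>Ck_on\<close> supplies a derivative of \<open>f' z v\<close> for each
    direction \<open>v\<close> separately; choice gathers these into one family
    \<open>f''\<close>.\<close>
  obtain f'' where f'': "\<And>v z. z \<in> UNIV \<times> T \<Longrightarrow> ((\<lambda>z. f' z v) has_derivative f'' v z) (at z)"
    "\<And>v w. continuous_on (UNIV \<times> T) (\<lambda>z. f'' v z w)"
  proof -
    have "\<forall>v. \<exists>g. (\<forall>z\<in>UNIV \<times> T. ((\<lambda>z. f' z v) has_derivative g z) (at z)) \<and>
        (\<forall>w. continuous_on (UNIV \<times> T) (\<lambda>z. g z w))"
      using f'(2) unfolding Ck_on.simps by blast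
    then obtain f'' where "\<forall>v. (\<forall>z\<in>UNIV \<times> T. ((\<lambda>z. f' z v) has_derivative f'' v z) (at z)) \<and>
        (\<forall>w. continuous_on (UNIV \<times> T) (\<lambda>z. f'' v z w))"
      unfolding choice_iff ..
    then show thesis by (intro that[of f'']) blast+
  qed
  have sym: "f'' v (x, t) w = f'' w (x, t) v" for v w
    by (rule second_derivative_symmetric[OF op _ f'(1) f'']) (simp add: assms(3))
  have dl: "((\<lambda>(x, t). dx l f x t) has_derivative f'' (axis l 1, 0) (x, t)) (at (x, t))" for l
    by (rule has_derivative_transform_within_open[OF f''(1) op]) (use assms(3) in \<open>auto simp: f'(3,4)\<close>)
  have dT: "((\<lambda>(x, t). dt f x t) has_derivative f'' (0, 1) (x, t)) (at (x, t))"
    by (rule has_derivative_transform_within_open[OF f''(1) op]) (use assms(3) in \<open>auto simp: f'(3,4)\<close>)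
  show "dx k (dx l f) x t = dx l (dx k f) x t"
    unfolding dx_eq_derivative[OF dl] by (rule sym)
  show "dt (dx k f) x t = dx k (dt f) x t"
    unfolding dx_eq_derivative[OF dT] dt_eq_derivative(2)[OF dl] by (rule sym)
qed

lemma smooth_2_partial:
  assumes "smooth T 2 f" "open T"
  shows "smooth T 1 (dx l f)" and "smooth T 1 (dt f)"
  using smooth_partial[of T "Suc 0" f, folded numeral_2_eq_2 One_nat_def, OF assms] .


section \<open>Momentum balance of a single layer\<close>

text \<open>The factor of \<open>H ^ (q i + q j + 1)\<close> in the integral of
  \<open>z ^ q i * z ^ q j\<close> over \<open>0 \<le> z \<le> H\<close>. The exponents
  \<open>q\<close> will be \<open>\<lambda>j. 2 * j\<close> in the upper layer and \<open>p\<close>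
  in the lower one.\<close>

definition horizontal_coeff :: "(nat \<Rightarrow> nat) \<Rightarrow> nat \<Rightarrow> nat \<Rightarrow> real" where
  "horizontal_coeff q i j = 1 / (real (q i) + real (q j) + 1)"

text \<open>The analogous factor for the product of the derivatives of \<open>z ^ q i\<close> and
  \<open>z ^ q j\<close>. A zero denominator forces one exponent to be 0, hence the case 0 / 0 =
  0.\<close>

definition vertical_coeff :: "(nat \<Rightarrow> nat) \<Rightarrow> nat \<Rightarrow> nat \<Rightarrow> real" where
  "vertical_coeff q i j = real (q i) * real (q j) / (real (q i) + real (q j) - 1)"

text \<open>The approximate velocity potential of the layer at the interface, with \<open>z\<close>
  measured from the rigid wall.\<close>

definition layer_potential :: "(nat \<Rightarrow> nat) \<Rightarrow> nat \<Rightarrow> (real^'n::finite \<Rightarrow> real \<Rightarrow> real) \<Rightarrow>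
    (nat \<Rightarrow> real^'n \<Rightarrow> real \<Rightarrow> real) \<Rightarrow> real^'n \<Rightarrow> real \<Rightarrow> real" where
  "layer_potential q M H \<phi> x t = (\<Sum>j\<le>M. H x t ^ q j * \<phi> j x t)"

text \<open>The \<open>z\<close>-derivative of that potential at the interface. In the upper layer
  \<open>z\<close> points downwards, so \<open>w1\<close> is its negative.\<close>

definition layer_w :: "(nat \<Rightarrow> nat) \<Rightarrow> nat \<Rightarrow> (real^'n::finite \<Rightarrow> real \<Rightarrow> real) \<Rightarrow>
    (nat \<Rightarrow> real^'n \<Rightarrow> real \<Rightarrow> real) \<Rightarrow> real^'n \<Rightarrow> real \<Rightarrow> real" where
  "layer_w q M H \<phi> x t = (\<Sum>j\<le>M. real (q j) * H x t ^ (q j - 1) * \<phi> j x t)"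

text \<open>Kinetic energy of the layer per unit density, integrated over its thickness.\<close>

definition layer_energy :: "(nat \<Rightarrow> nat) \<Rightarrow> nat \<Rightarrow> (real^'n::finite \<Rightarrow> real \<Rightarrow> real) \<Rightarrow>
    (nat \<Rightarrow> real^'n \<Rightarrow> real \<Rightarrow> real) \<Rightarrow> real^'n \<Rightarrow> real \<Rightarrow> real" where
  "layer_energy q M H \<phi> x t = 1/2 * (\<Sum>i\<le>M. \<Sum>j\<le>M.
     horizontal_coeff q i j * H x t ^ (q i + q j + 1) * (grad (\<phi> i) x t \<bullet> grad (\<phi> j) x t)
     + vertical_coeff q i j * H x t ^ (q i + q j - 1) * \<phi> i x t * \<phi> j x t)"

text \<open>Given entry by entry because \<open>dx\<close> acts on real-valued functions.\<close>

definition layer_flux :: "(nat \<Rightarrow> nat) \<Rightarrow> nat \<Rightarrow> (real^'n::finite \<Rightarrow> real \<Rightarrow> real) \<Rightarrow>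
    (nat \<Rightarrow> real^'n \<Rightarrow> real \<Rightarrow> real) \<Rightarrow> 'n \<Rightarrow> 'n \<Rightarrow> real^'n \<Rightarrow> real \<Rightarrow> real" where
  "layer_flux q M H \<phi> k l x t = (\<Sum>i\<le>M. \<Sum>j\<le>M.
     horizontal_coeff q i j * H x t ^ (q i + q j + 1) * (dx k (\<phi> i) x t * dx l (\<phi> j) x t))"

text \<open>The layer's share of the Bernoulli equation, with density and gravity term left
  out.\<close>

definition layer_head :: "(nat \<Rightarrow> nat) \<Rightarrow> nat \<Rightarrow> (real^'n::finite \<Rightarrow> real \<Rightarrow> real) \<Rightarrow>
    (nat \<Rightarrow> real^'n \<Rightarrow> real \<Rightarrow> real) \<Rightarrow> real^'n \<Rightarrow> real \<Rightarrow> real" where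
  "layer_head q M H \<phi> x t = (\<Sum>j\<le>M. H x t ^ q j * dt (\<phi> j) x t)
     + 1/2 * ((norm (\<Sum>j\<le>M. H x t ^ q j *\<^sub>R grad (\<phi> j) x t))\<^sup>2 + (layer_w q M H \<phi> x t)\<^sup>2)"

section \<open>Derivatives of the depth-integrated coefficients\<close>

text \<open>Differentiating an integral from 0 to \<open>H\<close> in \<open>H\<close> returns the
  integrand at \<open>H\<close>. Here \<open>z\<close> and \<open>d\<close> stand for the values of
  \<open>H\<close> and of its derivative.\<close>

lemma horizontal_coeff_power_deriv:
  "horizontal_coeff q i j * (real (q i + q j + 1) * z ^ (q i + q j + 1 - 1) * d)
    = d * (z ^ q i * z ^ q j)"
  by (simp add: horizontal_coeff_def power_add add.commute)

text \<open>
  If \<open>q i = 0\<close> or \<open>q j = 0\<close>, the truncated exponents and a possibly zero denominator do no harm,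
  because both sides are \<open>0\<close>.
\<close>

lemma vertical_coeff_power_deriv:
  "vertical_coeff q i j * (real (q i + q j - 1) * z ^ (q i + q j - 1 - 1) * d) =
    d * ((real (q i) * z ^ (q i - 1)) * (real (q j) * z ^ (q j - 1)))"
proof (cases "q i = 0 \<or> q j = 0")
  case False
  then have "real (q i + q j - 1) = real (q i) + real (q j) - 1" by (simp add: of_nat_diff)
  moreover have "real (q i) + real (q j) - 1 \<noteq> 0" using False by linarith
  moreover have "z ^ (q i + q j - 1 - 1) = z ^ (q i - 1) * z ^ (q j - 1)"
    using False by (simp add: power_add[symmetric])
  ultimately show ?thesis by (simp add: vertical_coeff_def)
qed (auto simp: vertical_coeff_def)

lemmas smooth_intros = smooth_const smooth_add smooth_diff smooth_mult smooth_power smooth_sum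

lemma inner_grad: "grad f x t \<bullet> grad g x t = (\<Sum>l\<in>UNIV. dx l f x t * dx l g x t)"
  by (simp add: inner_vec_def grad_def)

section \<open>Regularity and first derivatives of the layer quantities\<close>

lemma smooth_layer_potential:
  assumes "smooth T k H" "\<And>j. j \<le> M \<Longrightarrow> smooth T k (\<phi> j)"
  shows "smooth T k (layer_potential q M H \<phi>)"
  unfolding layer_potential_def[abs_def] using assms by (intro smooth_intros) auto

lemma smooth_layer_energy:
  assumes "open T" "smooth T 2 H" "\<And>j. j \<le> M \<Longrightarrow> smooth T 2 (\<phi> j)"
  shows "smooth T 1 (layer_energy q M H \<phi>)"
  unfolding layer_energy_def[abs_def] inner_grad using assms
  by (intro smooth_intros) (auto intro: smooth_2_imp_1 smooth_2_partial simp del: One_nat_def)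

lemma smooth_layer_flux:
  assumes "open T" "smooth T 2 H" "\<And>j. j \<le> M \<Longrightarrow> smooth T 2 (\<phi> j)"
  shows "smooth T 1 (layer_flux q M H \<phi> k l)"
  unfolding layer_flux_def[abs_def] using assms
  by (intro smooth_intros) (auto intro: smooth_2_imp_1 smooth_2_partial simp del: One_nat_def)

text \<open>Differentiating the powers of \<open>H\<close> produces \<open>layer_w\<close>. Both
  formulas carry it in the same way, so it drops out of
  \<open>dx k H * dt \<psi> - dt H * dx k \<psi>\<close>, where \<open>\<psi>\<close> is the layer
  potential.\<close>

lemma partial_layer_potential:
  assumes "smooth T 1 H" "\<And>j. j \<le> M \<Longrightarrow> smooth T 1 (\<phi> j)" "t \<in> T"
  shows "dx k (layer_potential q M H \<phi>) x t =
      (\<Sum>j\<le>M. H x t ^ q j * dx k (\<phi> j) x t) + dx k H x t * layer_w q M H \<phi> x t"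
    and "dt (layer_potential q M H \<phi>) x t =
      (\<Sum>j\<le>M. H x t ^ q j * dt (\<phi> j) x t) + dt H x t * layer_w q M H \<phi> x t"
proof -
  have s: "smooth T 1 (\<lambda>y s. H y s ^ q j * \<phi> j y s)" if "j \<in> {..M}" for j
    using assms that by (intro smooth_intros) auto
  have "dx k (\<lambda>y s. H y s ^ q j * \<phi> j y s) x t = H x t ^ q j * dx k (\<phi> j) x t
      + dx k H x t * (real (q j) * H x t ^ (q j - 1) * \<phi> j x t)" if "j \<in> {..M}" for j
    using partial_mult(1)[OF smooth_power[OF assms(1)] assms(2,3)] that
      partial_power(1)[OF assms(1,3)] by simp
  moreover have "dx k (layer_potential q M H \<phi>) x t = (\<Sum>j\<le>M. dx k (\<lambda>y s. H y s ^ q j * \<phi> j y s) x t)"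
    unfolding layer_potential_def[abs_def] by (rule partial_sum(1)[OF _ assms(3)]) (rule s)
  ultimately show "dx k (layer_potential q M H \<phi>) x t =
      (\<Sum>j\<le>M. H x t ^ q j * dx k (\<phi> j) x t) + dx k H x t * layer_w q M H \<phi> x t"
    by (simp add: layer_w_def sum.distrib sum_distrib_left)
  have "dt (\<lambda>y s. H y s ^ q j * \<phi> j y s) x t = H x t ^ q j * dt (\<phi> j) x t
      + dt H x t * (real (q j) * H x t ^ (q j - 1) * \<phi> j x t)" if "j \<in> {..M}" for j
    using partial_mult(2)[OF smooth_power[OF assms(1)] assms(2,3)] that
      partial_power(2)[OF assms(1,3)] by simp
  moreover have "dt (layer_potential q M H \<phi>) x t = (\<Sum>j\<le>M. dt (\<lambda>y s. H y s ^ q j * \<phi> j y s) x t)"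
    unfolding layer_potential_def[abs_def] by (rule partial_sum(2)[OF _ assms(3)]) (rule s)
  ultimately show "dt (layer_potential q M H \<phi>) x t =
      (\<Sum>j\<le>M. H x t ^ q j * dt (\<phi> j) x t) + dt H x t * layer_w q M H \<phi> x t"
    by (simp add: layer_w_def sum.distrib sum_distrib_left)
qed


lemma norm_sum_scaleR_power2:
  fixes v :: "nat \<Rightarrow> 'a::real_inner"
  shows "(norm (\<Sum>j\<le>M. c j *\<^sub>R v j))\<^sup>2 = (\<Sum>i\<le>M. \<Sum>j\<le>M. c i * c j * (v i \<bullet> v j))"
  unfolding power2_norm_eq_inner inner_sum_left unfolding inner_sum_right by (simp add: mult_ac)

text \<open>The sums \<open>A i j * S i j\<close> occur both in the divergence of the flux and in
  the energy gradient and cancel; what remains contains exactly the layer equations multiplied by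
  \<open>dx k (\<phi> i)\<close>. These equations are only needed at the point
  \<open>(x, t)\<close>.\<close>

lemma layer_momentum_identity:
  fixes H :: "real^'n::finite \<Rightarrow> real \<Rightarrow> real"
  assumes T: "open T" "t \<in> T" and H: "smooth T 2 H"
    and \<phi>: "\<And>j. j \<le> M \<Longrightarrow> smooth T 2 (\<phi> j)"
    and eq: "\<And>i. i \<le> M \<Longrightarrow> H x t ^ q i * dt H x t + (\<Sum>j\<le>M.
      vdiv (\<lambda>y s. (horizontal_coeff q i j * H y s ^ (q i + q j + 1)) *\<^sub>R grad (\<phi> j) y s) x t
      - vertical_coeff q i j * H x t ^ (q i + q j - 1) * \<phi> j x t) = 0"
  shows "(\<Sum>l\<in>UNIV. dx l (layer_flux q M H \<phi> k l) x t) - dx k (layer_energy q M H \<phi>) x t =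
    dx k H x t * dt (layer_potential q M H \<phi>) x t - dt H x t * dx k (layer_potential q M H \<phi>) x t
    - dx k H x t * layer_head q M H \<phi> x t"
proof -
  define A where "A i j y s = horizontal_coeff q i j * H y s ^ (q i + q j + 1)" for i j y s
  define B where "B i j y s = vertical_coeff q i j * H y s ^ (q i + q j - 1)" for i j y s
  define V where "V i j = vdiv (\<lambda>y s. A i j y s *\<^sub>R grad (\<phi> j) y s) x t" for i j
  \<comment> \<open>\<open>S i j\<close> is the gradient of \<open>\<phi> j\<close> times the
    \<open>k\<close>-th derivative of the gradient of \<open>\<phi> i\<close>; it is not symmetric
    in \<open>i\<close> and \<open>j\<close>.\<close>
  define S where "S i j = (\<Sum>l\<in>UNIV. dx l (\<phi> j) x t * dx k (dx l (\<phi> i)) x t)" for i j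
  define c where "c j = real (q j) * H x t ^ (q j - 1)" for j
  note H1 = smooth_2_imp_1[OF H]
  note \<phi>1 = smooth_2_imp_1[OF \<phi>]
  note d\<phi>1 = smooth_2_partial(1)[OF \<phi> T(1)]
  have A1: "smooth T 1 (A i j)" and B1: "smooth T 1 (B i j)" for i j
    unfolding A_def[abs_def] B_def[abs_def] using H1 by (intro smooth_intros; assumption)+
  have dA: "dx k (A i j) x t = dx k H x t * (H x t ^ q i * H x t ^ q j)" for i j
    unfolding A_def[abs_def] partial_cmult(1)[OF smooth_power[OF H1] T(2)] partial_power(1)[OF H1 T(2)]
    by (rule horizontal_coeff_power_deriv)
  have dB: "dx k (B i j) x t = dx k H x t * (c i * c j)" for i j
    unfolding B_def[abs_def] c_def partial_cmult(1)[OF smooth_power[OF H1] T(2)] partial_power(1)[OF H1 T(2)]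
    by (rule vertical_coeff_power_deriv)

  \<comment> \<open>\<open>A i j * dx l (\<phi> j)\<close> is kept as one factor, so that summing
    its derivatives over \<open>l\<close> gives the divergence \<open>V i j\<close>. The mixed
    derivative of \<open>\<phi> i\<close> is reordered to match \<open>S i j\<close>.\<close>
  have "(\<Sum>l\<in>UNIV. dx l (layer_flux q M H \<phi> k l) x t) = (\<Sum>l\<in>UNIV. \<Sum>i\<le>M. \<Sum>j\<le>M.
      dx k (\<phi> i) x t * dx l (\<lambda>y s. A i j y s * dx l (\<phi> j) y s) x t
      + A i j x t * (dx l (\<phi> j) x t * dx k (dx l (\<phi> i)) x t))"
  proof (rule sum.cong[OF refl])
    fix l :: 'n
    have m: "smooth T 1 (\<lambda>y s. A i j y s * dx l (\<phi> j) y s)" if "j \<le> M" for i j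
      by (rule smooth_mult[OF A1 d\<phi>1[OF that]])
    have m2: "smooth T 1 (\<lambda>y s. dx k (\<phi> i) y s * (A i j y s * dx l (\<phi> j) y s))"
      if "i \<le> M" "j \<le> M" for i j
      by (rule smooth_mult[OF d\<phi>1[OF that(1)] m[OF that(2)]])
    have fl: "layer_flux q M H \<phi> k l
        = (\<lambda>y s. \<Sum>i\<le>M. \<Sum>j\<le>M. dx k (\<phi> i) y s * (A i j y s * dx l (\<phi> j) y s))"
      by (simp add: layer_flux_def A_def fun_eq_iff mult_ac)
    have "dx l (layer_flux q M H \<phi> k l) x t
        = (\<Sum>i\<le>M. dx l (\<lambda>y s. \<Sum>j\<le>M. dx k (\<phi> i) y s * (A i j y s * dx l (\<phi> j) y s)) x t)"
      unfolding fl by (rule partial_sum(1)[OF _ T(2)]) (auto intro!: smooth_sum m2 simp del: One_nat_def)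
    also have "\<dots> = (\<Sum>i\<le>M. \<Sum>j\<le>M. dx l (\<lambda>y s. dx k (\<phi> i) y s * (A i j y s * dx l (\<phi> j) y s)) x t)"
      by (intro sum.cong[OF refl] partial_sum(1)[OF _ T(2)]) (auto intro!: m2 simp del: One_nat_def)
    also have "\<dots> = (\<Sum>i\<le>M. \<Sum>j\<le>M.
      dx k (\<phi> i) x t * dx l (\<lambda>y s. A i j y s * dx l (\<phi> j) y s) x t
      + A i j x t * (dx l (\<phi> j) x t * dx k (dx l (\<phi> i)) x t))"
    proof (intro sum.cong[OF refl])
      fix i j assume "i \<in> {..M}" "j \<in> {..M}"
      then have ij: "i \<le> M" "j \<le> M" by auto
      show "dx l (\<lambda>y s. dx k (\<phi> i) y s * (A i j y s * dx l (\<phi> j) y s)) x t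
        = dx k (\<phi> i) x t * dx l (\<lambda>y s. A i j y s * dx l (\<phi> j) y s) x t
          + A i j x t * (dx l (\<phi> j) x t * dx k (dx l (\<phi> i)) x t)"
        unfolding partial_mult(1)[OF d\<phi>1[OF ij(1)] m[OF ij(2)] T(2)]
          partial_commute(1)[OF \<phi>[OF ij(1)] T, of l k]
        by (simp only: mult_ac)
    qed
    finally show "dx l (layer_flux q M H \<phi> k l) x t = \<dots>" .
  qed
  also have "\<dots> = (\<Sum>i\<le>M. \<Sum>j\<le>M. \<Sum>l\<in>UNIV.
      dx k (\<phi> i) x t * dx l (\<lambda>y s. A i j y s * dx l (\<phi> j) y s) x t
      + A i j x t * (dx l (\<phi> j) x t * dx k (dx l (\<phi> i)) x t))"
    by (subst sum.swap) (intro sum.cong[OF refl] sum.swap)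
  also have "\<dots> = (\<Sum>i\<le>M. dx k (\<phi> i) x t * (\<Sum>j\<le>M. V i j)) + (\<Sum>i\<le>M. \<Sum>j\<le>M. A i j x t * S i j)"
    by (simp add: sum.distrib sum_distrib_left V_def S_def vdiv_def grad_def)
  finally have flux: "(\<Sum>l\<in>UNIV. dx l (layer_flux q M H \<phi> k l) x t)
    = (\<Sum>i\<le>M. dx k (\<phi> i) x t * (\<Sum>j\<le>M. V i j)) + (\<Sum>i\<le>M. \<Sum>j\<le>M. A i j x t * S i j)" .

  define G where "G i j y s = (\<Sum>l\<in>UNIV. dx l (\<phi> i) y s * dx l (\<phi> j) y s)" for i j y s
  have G1: "smooth T 1 (G i j)" if "i \<le> M" "j \<le> M" for i j
    unfolding G_def[abs_def] using that d\<phi>1 by (intro smooth_intros) auto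
  have dG: "dx k (G i j) x t = S i j + S j i" if "i \<le> M" "j \<le> M" for i j
  proof -
    have "dx k (G i j) x t = (\<Sum>l\<in>UNIV. dx k (\<lambda>y s. dx l (\<phi> i) y s * dx l (\<phi> j) y s) x t)"
      unfolding G_def[abs_def] using that
      by (intro partial_sum(1)[OF _ T(2)] smooth_mult d\<phi>1)
    then show ?thesis
      unfolding partial_mult(1)[OF d\<phi>1[OF that(1)] d\<phi>1[OF that(2)] T(2)]
      by (simp add: S_def sum.distrib mult.commute)
  qed
  \<comment> \<open>\<open>P i j\<close> is the summand of twice the layer energy.\<close>
  define P where "P i j y s = A i j y s * G i j y s + B i j y s * (\<phi> i y s * \<phi> j y s)" for i j y s
  have P1: "smooth T 1 (P i j)" if "i \<le> M" "j \<le> M" for i j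
    unfolding P_def[abs_def]
    by (intro smooth_add smooth_mult A1 B1 G1[OF that] \<phi>1[OF that(1)] \<phi>1[OF that(2)])
  \<comment> \<open>Since \<open>A\<close> and \<open>B\<close> are symmetric, the terms are grouped
    in pairs exchanged by \<open>i\<close> and \<open>j\<close>. In the double sum each pair counts
    twice, which absorbs the factor 1/2 of the energy; the last two terms sum to the squared
    velocities at the interface.\<close>
  have dP: "dx k (P i j) x t = (A i j x t * S i j + A j i x t * S j i)
      + (B i j x t * dx k (\<phi> i) x t * \<phi> j x t + B j i x t * dx k (\<phi> j) x t * \<phi> i x t)
      + dx k H x t * (H x t ^ q i * H x t ^ q j * (grad (\<phi> i) x t \<bullet> grad (\<phi> j) x t))
      + dx k H x t * ((c i * \<phi> i x t) * (c j * \<phi> j x t))" if ij: "i \<le> M" "j \<le> M" for i j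
  proof -
    have sym: "A j i = A i j" "B j i = B i j"
      by (simp_all add: A_def B_def fun_eq_iff horizontal_coeff_def vertical_coeff_def add.commute mult.commute)
    note m = smooth_mult[OF \<phi>1[OF ij(1)] \<phi>1[OF ij(2)]]
    have "dx k (P i j) x t = A i j x t * dx k (G i j) x t + dx k (A i j) x t * G i j x t
        + (B i j x t * dx k (\<lambda>y s. \<phi> i y s * \<phi> j y s) x t + dx k (B i j) x t * (\<phi> i x t * \<phi> j x t))"
      unfolding P_def[abs_def] partial_add(1)[OF smooth_mult[OF A1 G1[OF ij]] smooth_mult[OF B1 m] T(2)]
        partial_mult(1)[OF A1 G1[OF ij] T(2)] partial_mult(1)[OF B1 m T(2)] ..
    also have "dx k (\<lambda>y s. \<phi> i y s * \<phi> j y s) x t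
        = \<phi> i x t * dx k (\<phi> j) x t + dx k (\<phi> i) x t * \<phi> j x t"
      by (rule partial_mult(1)[OF \<phi>1[OF ij(1)] \<phi>1[OF ij(2)] T(2)])
    finally show ?thesis
      unfolding dA dB dG[OF ij] sym inner_grad G_def[symmetric]
      by (simp only: distrib_left distrib_right mult_ac add_ac)
  qed
  have en: "layer_energy q M H \<phi> = (\<lambda>y s. 1/2 * (\<Sum>i\<le>M. \<Sum>j\<le>M. P i j y s))"
    by (simp add: fun_eq_iff layer_energy_def P_def A_def B_def G_def inner_grad mult.assoc)
  have "dx k (layer_energy q M H \<phi>) x t = 1/2 * dx k (\<lambda>y s. \<Sum>i\<le>M. \<Sum>j\<le>M. P i j y s) x t"
    unfolding en by (rule partial_cmult(1)[OF _ T(2)]) (intro smooth_sum P1; simp)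
  also have "dx k (\<lambda>y s. \<Sum>i\<le>M. \<Sum>j\<le>M. P i j y s) x t = (\<Sum>i\<le>M. dx k (\<lambda>y s. \<Sum>j\<le>M. P i j y s) x t)"
    by (rule partial_sum(1)[OF _ T(2)]) (intro smooth_sum P1; simp)
  also have "\<dots> = (\<Sum>i\<le>M. \<Sum>j\<le>M. dx k (P i j) x t)"
    by (intro sum.cong[OF refl] partial_sum(1)[OF _ T(2)] P1) auto
  also have "\<dots> = (\<Sum>i\<le>M. \<Sum>j\<le>M. (A i j x t * S i j + A j i x t * S j i)
      + (B i j x t * dx k (\<phi> i) x t * \<phi> j x t + B j i x t * dx k (\<phi> j) x t * \<phi> i x t)
      + dx k H x t * (H x t ^ q i * H x t ^ q j * (grad (\<phi> i) x t \<bullet> grad (\<phi> j) x t))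
      + dx k H x t * ((c i * \<phi> i x t) * (c j * \<phi> j x t)))"
    by (intro sum.cong[OF refl] dP) auto
  also have "\<dots> = 2 * (\<Sum>i\<le>M. \<Sum>j\<le>M. A i j x t * S i j)
      + 2 * (\<Sum>i\<le>M. \<Sum>j\<le>M. B i j x t * dx k (\<phi> i) x t * \<phi> j x t)
      + dx k H x t * (\<Sum>i\<le>M. \<Sum>j\<le>M. H x t ^ q i * H x t ^ q j * (grad (\<phi> i) x t \<bullet> grad (\<phi> j) x t))
      + dx k H x t * (\<Sum>i\<le>M. \<Sum>j\<le>M. (c i * \<phi> i x t) * (c j * \<phi> j x t))"
    unfolding sum.distrib sum_distrib_left[symmetric]
      sum.swap[of "\<lambda>i j. A j i x t * S j i"] sum.swap[of "\<lambda>i j. B j i x t * dx k (\<phi> j) x t * \<phi> i x t"]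
    by simp
  also have "(\<Sum>i\<le>M. \<Sum>j\<le>M. H x t ^ q i * H x t ^ q j * (grad (\<phi> i) x t \<bullet> grad (\<phi> j) x t))
      = (norm (\<Sum>j\<le>M. H x t ^ q j *\<^sub>R grad (\<phi> j) x t))\<^sup>2"
    by (rule norm_sum_scaleR_power2[symmetric])
  also have "(\<Sum>i\<le>M. \<Sum>j\<le>M. (c i * \<phi> i x t) * (c j * \<phi> j x t)) = (layer_w q M H \<phi> x t)\<^sup>2"
    by (simp add: layer_w_def c_def power2_eq_square sum_product)
  finally have energy: "dx k (layer_energy q M H \<phi>) x t = (\<Sum>i\<le>M. \<Sum>j\<le>M. A i j x t * S i j)
      + (\<Sum>i\<le>M. \<Sum>j\<le>M. B i j x t * dx k (\<phi> i) x t * \<phi> j x t)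
      + 1/2 * dx k H x t * ((norm (\<Sum>j\<le>M. H x t ^ q j *\<^sub>R grad (\<phi> j) x t))\<^sup>2 + (layer_w q M H \<phi> x t)\<^sup>2)"
    by (simp add: algebra_simps)

  \<comment> \<open>What is left of flux and energy is the \<open>i\<close>-th layer equation
    without its \<open>dt H\<close> term, weighted by \<open>dx k (\<phi> i)\<close>.\<close>
  have "(\<Sum>i\<le>M. dx k (\<phi> i) x t * (\<Sum>j\<le>M. V i j))
      - (\<Sum>i\<le>M. \<Sum>j\<le>M. B i j x t * dx k (\<phi> i) x t * \<phi> j x t)
      = (\<Sum>i\<le>M. dx k (\<phi> i) x t * (\<Sum>j\<le>M. V i j - B i j x t * \<phi> j x t))"
    by (simp add: sum_subtractf sum_distrib_left right_diff_distrib mult_ac)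
  also have "\<dots> = (\<Sum>i\<le>M. dx k (\<phi> i) x t * (- (H x t ^ q i * dt H x t)))"
  proof (intro sum.cong refl arg_cong2[where f = "(*)"])
    fix i assume "i \<in> {..M}"
    then show "(\<Sum>j\<le>M. V i j - B i j x t * \<phi> j x t) = - (H x t ^ q i * dt H x t)"
      using eq[of i] unfolding V_def A_def B_def by simp
  qed
  also have "\<dots> = - dt H x t * (\<Sum>i\<le>M. H x t ^ q i * dx k (\<phi> i) x t)"
    by (simp add: sum_distrib_left sum_negf mult_ac)
  finally have "(\<Sum>l\<in>UNIV. dx l (layer_flux q M H \<phi> k l) x t) - dx k (layer_energy q M H \<phi>) x t
      = - dt H x t * (\<Sum>i\<le>M. H x t ^ q i * dx k (\<phi> i) x t)
      - 1/2 * dx k H x t * ((norm (\<Sum>j\<le>M. H x t ^ q j *\<^sub>R grad (\<phi> j) x t))\<^sup>2 + (layer_w q M H \<phi> x t)\<^sup>2)"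
    using flux energy by linarith
  \<comment> \<open>The \<open>layer_w\<close> terms cancel between the two potential derivatives,
    and the sum with \<open>dt (\<phi> j)\<close> cancels against that in
    \<open>layer_head\<close>.\<close>
  moreover have "dx k (layer_potential q M H \<phi>) x t =
      (\<Sum>j\<le>M. H x t ^ q j * dx k (\<phi> j) x t) + dx k H x t * layer_w q M H \<phi> x t"
    by (rule partial_layer_potential(1)[OF H1 \<phi>1 T(2)])
  moreover have "dt (layer_potential q M H \<phi>) x t =
      (\<Sum>j\<le>M. H x t ^ q j * dt (\<phi> j) x t) + dt H x t * layer_w q M H \<phi> x t"
    by (rule partial_layer_potential(2)[OF H1 \<phi>1 T(2)])
  ultimately show ?thesis unfolding layer_head_def by algebra
qed


section \<open>Conservation of momentum\<close>

lemma phi_eq_layer_potential: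
  "phi N Ns p \<rho>1 \<rho>2 h1 h2 \<zeta> \<phi>1 \<phi>2 = (\<lambda>x t.
    \<rho>2 * layer_potential p Ns (H2 h2 \<zeta>) \<phi>2 x t
    - \<rho>1 * layer_potential (\<lambda>j. 2 * j) N (H1 h1 \<zeta>) \<phi>1 x t)"
  by (simp add: fun_eq_iff phi_def layer_potential_def)

lemma coeff_double:
  "1 / (2 * (real i + real j) + 1) = horizontal_coeff (\<lambda>j. 2 * j) i j"
  "4 * real i * real j / (2 * (real i + real j) - 1) = vertical_coeff (\<lambda>j. 2 * j) i j"
  by (simp_all add: horizontal_coeff_def vertical_coeff_def)

lemma energy_density_eq_layer_energy:
  "energy_density N Ns p g \<rho>1 \<rho>2 h1 h2 \<zeta> \<phi>1 \<phi>2 = (\<lambda>x t.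
    \<rho>1 * layer_energy (\<lambda>j. 2 * j) N (H1 h1 \<zeta>) \<phi>1 x t
    + \<rho>2 * layer_energy p Ns (H2 h2 \<zeta>) \<phi>2 x t + 1/2 * (\<rho>2 - \<rho>1) * g * \<zeta> x t ^ 2)"
  unfolding energy_density_def coeff_double layer_energy_def
  by (simp add: fun_eq_iff horizontal_coeff_def[of p] vertical_coeff_def[of p] distrib_left)

lemma momentum_flux_component:
  "momentum_flux N Ns p g \<rho>1 \<rho>2 h1 h2 \<zeta> \<phi>1 \<phi>2 x t $ k $ l =
    - (\<zeta> x t * dt (phi N Ns p \<rho>1 \<rho>2 h1 h2 \<zeta> \<phi>1 \<phi>2) x t
       + energy_density N Ns p g \<rho>1 \<rho>2 h1 h2 \<zeta> \<phi>1 \<phi>2 x t) * (if k = l then 1 else 0)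
    + \<rho>1 * layer_flux (\<lambda>j. 2 * j) N (H1 h1 \<zeta>) \<phi>1 k l x t
    + \<rho>2 * layer_flux p Ns (H2 h2 \<zeta>) \<phi>2 k l x t"
  unfolding momentum_flux_def coeff_double layer_flux_def
  by (simp add: tensor_def grad_def mat_def horizontal_coeff_def[of p] distrib_left)

text \<open>The momentum density is vector-valued, whereas the product rule and the commutation of
  derivatives are available for its real components.\<close>

lemma dt_nth:
  assumes "\<And>k. ((\<lambda>s. f x s $ k) has_vector_derivative D $ k) (at t)"
  shows "dt f x t = (D :: real^'n)"
proof -
  have "((\<lambda>s. f x s) has_vector_derivative D) (at t)"
    unfolding has_vector_derivative_def
    by (subst has_derivative_componentwise_within)
      (use assms in \<open>auto simp: Basis_vec_def inner_axis has_vector_derivative_def\<close>)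
  then show ?thesis unfolding dt_def by (rule vector_derivative_at)
qed

theorem proposition9p2:
  fixes N Ns :: nat
    and p :: "nat \<Rightarrow> nat"
    and g \<rho>1 \<rho>2 h1 h2 :: real
    and T :: "real set"
    and \<zeta> :: "real^'n::finite \<Rightarrow> real \<Rightarrow> real"
    and \<phi>1 \<phi>2 :: "nat \<Rightarrow> real^'n \<Rightarrow> real \<Rightarrow> real"
  assumes "p 0 = 0" and "strict_mono_on {..Ns} p"
    and "g > 0" and "\<rho>1 > 0" and "\<rho>2 > 0" and "h1 > 0" and "h2 > 0"
    and "open T" and "is_interval T"
    and "regular N Ns T \<zeta> \<phi>1 \<phi>2"
    and "\<forall>x. \<forall>t\<in>T. H1 h1 \<zeta> x t > 0 \<and> H2 h2 \<zeta> x t > 0"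
    and "kakinuma_solution N Ns p g \<rho>1 \<rho>2 h1 h2 T \<zeta> \<phi>1 \<phi>2"
  shows "\<forall>x. \<forall>t\<in>T.
    dt (momentum_density N Ns p \<rho>1 \<rho>2 h1 h2 \<zeta> \<phi>1 \<phi>2) x t
    + mdiv (momentum_flux N Ns p g \<rho>1 \<rho>2 h1 h2 \<zeta> \<phi>1 \<phi>2) x t = 0"
proof (intro allI ballI)
  fix x :: "real^'n" and t assume t: "t \<in> T"
  note T = \<open>open T\<close> t
  \<comment> \<open>Final letters \<open>A\<close> and \<open>B\<close> mark the upper and the lower
    layer.\<close>
  define HA where "HA = H1 h1 \<zeta>"
  define HB where "HB = H2 h2 \<zeta>"
  define \<Phi> where "\<Phi> = phi N Ns p \<rho>1 \<rho>2 h1 h2 \<zeta> \<phi>1 \<phi>2"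
  define E where "E = energy_density N Ns p g \<rho>1 \<rho>2 h1 h2 \<zeta> \<phi>1 \<phi>2"
  define EA where "EA = layer_energy (\<lambda>j. 2 * j) N HA \<phi>1"
  define EB where "EB = layer_energy p Ns HB \<phi>2"
  define PA where "PA = layer_potential (\<lambda>j. 2 * j) N HA \<phi>1"
  define PB where "PB = layer_potential p Ns HB \<phi>2"
  define FA where "FA = layer_flux (\<lambda>j. 2 * j) N HA \<phi>1"
  define FB where "FB = layer_flux p Ns HB \<phi>2"

  have \<zeta>: "smooth T 2 \<zeta>" and \<phi>1: "\<And>j. j \<le> N \<Longrightarrow> smooth T 2 (\<phi>1 j)"
    and \<phi>2: "\<And>j. j \<le> Ns \<Longrightarrow> smooth T 2 (\<phi>2 j)"
    using \<open>regular N Ns T \<zeta> \<phi>1 \<phi>2\<close> by (auto simp: regular_def smooth_def)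
  note \<zeta>1 = smooth_2_imp_1[OF \<zeta>]
  have HA: "smooth T 2 HA" and HB: "smooth T 2 HB"
    unfolding HA_def H1_def[abs_def] HB_def H2_def[abs_def]
    by (intro smooth_intros \<zeta>)+
  have dHA: "dx k HA x t = - dx k \<zeta> x t" "dt HA x t = - dt \<zeta> x t" for k
    unfolding HA_def H1_def[abs_def] partial_diff[OF smooth_const \<zeta>1 t] partial_const by simp_all
  have dHB: "dx k HB x t = dx k \<zeta> x t" "dt HB x t = dt \<zeta> x t" for k
    unfolding HB_def H2_def[abs_def] partial_add[OF smooth_const \<zeta>1 t] partial_const by simp_all
  have sol: "\<And>i. i \<le> N \<Longrightarrow> kakinuma_eq1 N h1 \<zeta> \<phi>1 i x t" "\<And>i. i \<le> Ns \<Longrightarrow> kakinuma_eq2 Ns p h2 \<zeta> \<phi>2 i x t"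
    "kakinuma_eq3 N Ns p g \<rho>1 \<rho>2 h1 h2 \<zeta> \<phi>1 \<phi>2 x t"
    using \<open>kakinuma_solution N Ns p g \<rho>1 \<rho>2 h1 h2 T \<zeta> \<phi>1 \<phi>2\<close> t by (auto simp: kakinuma_solution_def)

  \<comment> \<open>Substituting \<open>dt \<zeta> = - dt HA\<close> and changing the overall sign
    gives the first Kakinuma equation the same form as the second.\<close>
  have eqA: "HA x t ^ (2 * i) * dt HA x t + (\<Sum>j\<le>N.
      vdiv (\<lambda>y s. (horizontal_coeff (\<lambda>j. 2 * j) i j * HA y s ^ (2 * i + 2 * j + 1)) *\<^sub>R grad (\<phi>1 j) y s) x t
      - vertical_coeff (\<lambda>j. 2 * j) i j * HA x t ^ (2 * i + 2 * j - 1) * \<phi>1 j x t) = 0"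
    if "i \<le> N" for i
    using sol(1)[OF that] unfolding kakinuma_eq1_def coeff_double dHA HA_def[symmetric]
    by (simp add: distrib_left)
  have eqB: "HB x t ^ p i * dt HB x t + (\<Sum>j\<le>Ns.
      vdiv (\<lambda>y s. (horizontal_coeff p i j * HB y s ^ (p i + p j + 1)) *\<^sub>R grad (\<phi>2 j) y s) x t
      - vertical_coeff p i j * HB x t ^ (p i + p j - 1) * \<phi>2 j x t) = 0"
    if "i \<le> Ns" for i
    using sol(2)[OF that] unfolding kakinuma_eq2_def dHB HB_def[symmetric]
      horizontal_coeff_def vertical_coeff_def .
  \<comment> \<open>The Bernoulli equation with its gravity terms moved to the right; the sign of
    \<open>w1\<close> disappears on squaring. Times \<open>dx k \<zeta>\<close>, the right-hand side
    is the gradient of the potential energy.\<close>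
  have heads: "\<rho>1 * layer_head (\<lambda>j. 2 * j) N HA \<phi>1 x t - \<rho>2 * layer_head p Ns HB \<phi>2 x t
      = (\<rho>2 - \<rho>1) * g * \<zeta> x t"
  proof -
    have vel: "u1 N h1 \<zeta> \<phi>1 x t = (\<Sum>j\<le>N. HA x t ^ (2 * j) *\<^sub>R grad (\<phi>1 j) x t)"
      "u2 Ns p h2 \<zeta> \<phi>2 x t = (\<Sum>j\<le>Ns. HB x t ^ p j *\<^sub>R grad (\<phi>2 j) x t)"
      "w1 N h1 \<zeta> \<phi>1 x t = - layer_w (\<lambda>j. 2 * j) N HA \<phi>1 x t"
      "w2 Ns p h2 \<zeta> \<phi>2 x t = layer_w p Ns HB \<phi>2 x t"
      by (simp_all add: u1_def u2_def w1_def w2_def layer_w_def HA_def HB_def)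
    show ?thesis
      using sol(3) unfolding kakinuma_eq3_def vel power2_minus HA_def[symmetric] HB_def[symmetric]
        layer_head_def
      by algebra
  qed

  have PA: "smooth T 2 PA" and PB: "smooth T 2 PB"
    unfolding PA_def PB_def using HA HB \<phi>1 \<phi>2 by (auto intro: smooth_layer_potential)
  have \<Phi>_eq: "\<Phi> = (\<lambda>y s. \<rho>2 * PB y s - \<rho>1 * PA y s)"
    by (simp add: \<Phi>_def phi_eq_layer_potential PA_def PB_def HA_def HB_def)
  have \<Phi>: "smooth T 2 \<Phi>"
    unfolding \<Phi>_eq by (intro smooth_intros PA PB)
  note PA1 = smooth_2_imp_1[OF PA] and PB1 = smooth_2_imp_1[OF PB]
  have d\<Phi>: "dx k \<Phi> x t = \<rho>2 * dx k PB x t - \<rho>1 * dx k PA x t"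
    "dt \<Phi> x t = \<rho>2 * dt PB x t - \<rho>1 * dt PA x t" for k
    unfolding \<Phi>_eq partial_diff[OF smooth_mult[OF smooth_const PB1] smooth_mult[OF smooth_const PA1] t]
      partial_cmult[OF PB1 t] partial_cmult[OF PA1 t] by simp_all
  have EA1: "smooth T 1 EA" and EB1: "smooth T 1 EB"
    unfolding EA_def EB_def using HA HB \<phi>1 \<phi>2 T by (auto intro: smooth_layer_energy simp del: One_nat_def)
  have E_eq: "E = (\<lambda>y s. \<rho>1 * EA y s + \<rho>2 * EB y s + (1/2 * (\<rho>2 - \<rho>1) * g) * \<zeta> y s ^ 2)"
    by (simp add: E_def energy_density_eq_layer_energy EA_def EB_def HA_def HB_def)
  have E1: "smooth T 1 E"
    unfolding E_eq by (intro smooth_intros EA1 EB1 \<zeta>1)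
  have dE: "dx k E x t = \<rho>1 * dx k EA x t + \<rho>2 * dx k EB x t + (\<rho>2 - \<rho>1) * g * \<zeta> x t * dx k \<zeta> x t" for k
  proof -
    note sA = smooth_mult[OF smooth_const[of T 1 \<rho>1] EA1]
      and sB = smooth_mult[OF smooth_const[of T 1 \<rho>2] EB1]
      and sZ = smooth_mult[OF smooth_const[of T 1 "1/2 * (\<rho>2 - \<rho>1) * g"] smooth_power[OF \<zeta>1, of 2]]
    show ?thesis
      unfolding E_eq partial_add(1)[OF smooth_add[OF sA sB] sZ t] partial_add(1)[OF sA sB t]
        partial_cmult(1)[OF EA1 t] partial_cmult(1)[OF EB1 t]
        partial_cmult(1)[OF smooth_power[OF \<zeta>1] t] partial_power(1)[OF \<zeta>1 t]
      by simp
  qed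
  have FA1: "smooth T 1 (FA k l)" and FB1: "smooth T 1 (FB k l)" for k l
    unfolding FA_def FB_def using HA HB \<phi>1 \<phi>2 T by (auto intro: smooth_layer_flux simp del: One_nat_def)

  note dx\<Phi>1 = smooth_2_partial(1)[OF \<Phi> T(1)] and dt\<Phi>1 = smooth_2_partial(2)[OF \<Phi> T(1)]
  \<comment> \<open>Exchanging \<open>dt\<close> and \<open>dx k\<close> on \<open>\<Phi>\<close>
    yields the term \<open>\<zeta> * dx k (dt \<Phi>)\<close>, which the divergence of the isotropic
    flux cancels.\<close>
  have density: "dt (momentum_density N Ns p \<rho>1 \<rho>2 h1 h2 \<zeta> \<phi>1 \<phi>2) x t
      = (\<chi> k. \<zeta> x t * dx k (dt \<Phi>) x t + dt \<zeta> x t * dx k \<Phi> x t)"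
  proof (rule dt_nth)
    fix k
    have "((\<lambda>s. \<zeta> x s * dx k \<Phi> x s) has_vector_derivative
        \<zeta> x t * dx k (dt \<Phi>) x t + dt \<zeta> x t * dx k \<Phi> x t) (at t)"
      using has_vector_derivative_dt[OF smooth_mult[OF \<zeta>1 dx\<Phi>1] t, of x k]
      unfolding partial_mult(2)[OF \<zeta>1 dx\<Phi>1 t] partial_commute(2)[OF \<Phi> T] .
    then show "((\<lambda>s. momentum_density N Ns p \<rho>1 \<rho>2 h1 h2 \<zeta> \<phi>1 \<phi>2 x s $ k) has_vector_derivative
        (\<chi> k. \<zeta> x t * dx k (dt \<Phi>) x t + dt \<zeta> x t * dx k \<Phi> x t) $ k) (at t)"
      by (simp add: momentum_density_def grad_def \<Phi>_def)
  qed

  have flux: "mdiv (momentum_flux N Ns p g \<rho>1 \<rho>2 h1 h2 \<zeta> \<phi>1 \<phi>2) x t $ k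
      = - (\<zeta> x t * dx k (dt \<Phi>) x t + dx k \<zeta> x t * dt \<Phi> x t + dx k E x t)
        + \<rho>1 * (\<Sum>l\<in>UNIV. dx l (FA k l) x t) + \<rho>2 * (\<Sum>l\<in>UNIV. dx l (FB k l) x t)" for k
  proof -
    define Q where "Q = (\<lambda>y s. \<zeta> y s * dt \<Phi> y s + E y s)"
    have Q1: "smooth T 1 Q" unfolding Q_def by (intro smooth_intros \<zeta>1 dt\<Phi>1 E1)
    have dQ: "dx k Q x t = \<zeta> x t * dx k (dt \<Phi>) x t + dx k \<zeta> x t * dt \<Phi> x t + dx k E x t"
      unfolding Q_def partial_add(1)[OF smooth_mult[OF \<zeta>1 dt\<Phi>1] E1 t] partial_mult(1)[OF \<zeta>1 dt\<Phi>1 t] ..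
    have "dx l (\<lambda>y s. momentum_flux N Ns p g \<rho>1 \<rho>2 h1 h2 \<zeta> \<phi>1 \<phi>2 y s $ k $ l) x t
        = (if k = l then - dx k Q x t else 0) + \<rho>1 * dx l (FA k l) x t + \<rho>2 * dx l (FB k l) x t" for l
    proof -
      \<comment> \<open>Entry \<open>(k, l)\<close> of minus the identity matrix: only
        \<open>l = k\<close> contributes, so the isotropic part \<open>Q\<close> enters row
        \<open>k\<close> as \<open>- dx k Q\<close>.\<close>
      define c :: real where "c = (if k = l then -1 else 0)"
      note sQ = smooth_mult[OF smooth_const[of T 1 c] Q1]
        and sA = smooth_mult[OF smooth_const[of T 1 \<rho>1] FA1[of k l]]
        and sB = smooth_mult[OF smooth_const[of T 1 \<rho>2] FB1[of k l]]
      have eq: "(\<lambda>y s. momentum_flux N Ns p g \<rho>1 \<rho>2 h1 h2 \<zeta> \<phi>1 \<phi>2 y s $ k $ l)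
          = (\<lambda>y s. c * Q y s + \<rho>1 * FA k l y s + \<rho>2 * FB k l y s)"
        by (simp add: fun_eq_iff momentum_flux_component Q_def c_def \<Phi>_def E_def FA_def FB_def HA_def HB_def)
      have "dx l (\<lambda>y s. c * Q y s + \<rho>1 * FA k l y s + \<rho>2 * FB k l y s) x t
          = c * dx l Q x t + \<rho>1 * dx l (FA k l) x t + \<rho>2 * dx l (FB k l) x t"
        unfolding partial_add(1)[OF smooth_add[OF sQ sA] sB t] partial_add(1)[OF sQ sA t]
          partial_cmult(1)[OF Q1 t] partial_cmult(1)[OF FA1 t] partial_cmult(1)[OF FB1 t] ..
      then show ?thesis unfolding eq by (simp add: c_def)
    qed
    then show ?thesis
      by (simp add: mdiv_def vdiv_def sum.distrib sum_distrib_left dQ)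
  qed

  have "(dt (momentum_density N Ns p \<rho>1 \<rho>2 h1 h2 \<zeta> \<phi>1 \<phi>2) x t
    + mdiv (momentum_flux N Ns p g \<rho>1 \<rho>2 h1 h2 \<zeta> \<phi>1 \<phi>2) x t) $ k = 0" for k
  proof -
    \<comment> \<open>Both derivatives of \<open>HA\<close> are minus those of
      \<open>\<zeta>\<close>, so the right-hand side changes sign compared with the lower
      layer.\<close>
    have A: "(\<Sum>l\<in>UNIV. dx l (FA k l) x t) - dx k EA x t = - dx k \<zeta> x t * dt PA x t
        + dt \<zeta> x t * dx k PA x t + dx k \<zeta> x t * layer_head (\<lambda>j. 2 * j) N HA \<phi>1 x t"
      using layer_momentum_identity[of T t HA N \<phi>1 x "\<lambda>j. 2 * j" k, OF T HA \<phi>1 eqA]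
      unfolding FA_def EA_def PA_def dHA by simp
    have B: "(\<Sum>l\<in>UNIV. dx l (FB k l) x t) - dx k EB x t = dx k \<zeta> x t * dt PB x t
        - dt \<zeta> x t * dx k PB x t - dx k \<zeta> x t * layer_head p Ns HB \<phi>2 x t"
      using layer_momentum_identity[of T t HB Ns \<phi>2 x p k, OF T HB \<phi>2 eqB]
      unfolding FB_def EB_def PB_def dHB by simp
    show ?thesis
      \<comment> \<open>With weights \<open>\<rho>1\<close> and \<open>\<rho>2\<close>,
        \<open>A\<close> and \<open>B\<close> add up to
        \<open>dx k \<zeta> * dt \<Phi> - dt \<zeta> * dx k \<Phi>\<close> plus
        \<open>dx k \<zeta>\<close> times the left side of \<open>heads\<close>, and every term
        cancels.\<close>
      unfolding vector_add_component density flux dE d\<Phi> vec_lambda_beta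
      using A B heads by algebra
  qed
  then show "dt (momentum_density N Ns p \<rho>1 \<rho>2 h1 h2 \<zeta> \<phi>1 \<phi>2) x t
    + mdiv (momentum_flux N Ns p g \<rho>1 \<rho>2 h1 h2 \<zeta> \<phi>1 \<phi>2) x t = 0"
    by (simp add: vec_eq_iff)
qed

end
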